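(* Let $n\ge1$ be an integer, $\sigma^2>0$, and $\mu\in S^n$, where $S^n$ is the unit $n$-sphere. For $0\le R\le\pi$ and integer $m\ge0$ let $$G_{m,\sigma^2}(R):=\Big(\frac i2\Big)^m\sqrt{\frac{\pi\sigma^2}{2}}\sum_{j=0}^m\binom mj(-1)^j\exp\Big(-\frac{(m-2j)^2\sigma^2}{2}\Big)\,\mathrm{erf}\Big(\frac{R}{\sqrt{2\sigma^2}}+\sqrt{\frac{\sigma^2}{2}}\,(m-2j)\,i\Big).$$ (a) The normalizing constant of the Riemannian normal distribution on $S^n$ is $$C_{S^n}(\mu,\sigma^2):=\int_{S^n}\exp\Big(-\frac{d(y,\mu)^2}{2\sigma^2}\Big)dy=\frac{2\pi^{n/2}}{\Gamma(\frac n2)}\big(G_{n-1,\sigma^2}(\pi)-G_{n-1,\sigma^2}(0)\big),$$ and so the Riemannian normal density on $S^n$ is $f(y;\mu,\sigma^2)=\exp\big(-d(y,\mu)^2/(2\sigma^2)\big)/C_{S^n}(\mu,\sigma^2)$ with this value of $C_{S^n}(\mu,\sigma^2)$. (b) If $y$ is a random point of $S^n$ with density $f(\cdot;\mu,\sigma^2)$, then the distribution function of $d(y,\mu)$ is $$F_{S^n}(R):=\Pr(d(y,\mu)\le R)=\begin{cases}0&\text{if }R<0,\\[2pt] \dfrac{G_{n-1,\sigma^2}(R)-G_{n-1,\sigma^2}(0)}{G_{n-1,\sigma^2}(\pi)-G_{n-1,\sigma^2}(0)}&\text{if }0\le R\le\pi,\\[6pt] 1&\text{if }R>\pi.\end{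cases}$$
   Context: $d$ is the geodesic distance on the unit sphere $S^n=\{p\in\mathbb{R}^{n+1}:\|p\|=1\}$ and $dy$ its Riemannian volume measure. The Riemannian normal distribution on a connected Riemannian manifold $M$ with parameters $\mu\in M$, $\sigma^2>0$ has density $f(y;\mu,\sigma^2)=\frac{1}{C_M(\mu,\sigma^2)}\exp\big(-\frac{d(y,\mu)^2}{2\sigma^2}\big)$ with respect to the Riemannian volume measure, where $C_M(\mu,\sigma^2)=\int_M\exp\big(-\frac{d(y,\mu)^2}{2\sigma^2}\big)dy$ (assumed finite). $i=\sqrt{-1}$, and $\mathrm{erf}(z)=\frac{2}{\sqrt\pi}\int_0^ze^{-t^2}dt$ is the (entire) error function for complex $z$. *)

theory Defs
  imports
    "HOL-Analysis.Analysis"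
    "HOL-Complex_Analysis.Complex_Analysis"
    "HOL-Probability.Probability"
    "HOL-Library.Numeral_Type"
begin

text \<open>Hypersurfaces live in \<open>real ^ ('n + 1)\<close> and are parametrised over open subsets of
  \<open>real ^ 'n\<close>; here \<open>'n + 1\<close> is the type of cardinality \<open>CARD('n) + 1\<close>, so that
  \<open>sphere (0 :: real ^ ('n + 1)) 1\<close> is the unit sphere of dimension \<open>CARD('n)\<close>.\<close>

text \<open>The geodesic (Riemannian) distance of a submanifold with the induced metric: the infimum
  of the lengths of piecewise $C^1$ curves inside \<open>S\<close>. Writing the length with
  \<open>has_integral\<close> excludes curves with non-integrable speed, to which
  \<open>integral\<close> would assign length 0.\<close>

definition geodesic_dist :: "'a::euclidean_space set \<Rightarrow> 'a \<Rightarrow> 'a \<Rightarrow> real" where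
  "geodesic_dist S p q = Inf {L. \<exists>\<gamma>. valid_path \<gamma> \<and> path_image \<gamma> \<subseteq> S \<and>
      pathstart \<gamma> = p \<and> pathfinish \<gamma> = q \<and>
      ((\<lambda>t. norm (vector_derivative \<gamma> (at t))) has_integral L) {0..1}}"

text \<open>\<open>\<phi>\<close>, with derivative \<open>\<phi>'\<close>, is a $C^1$ local parametrisation (inverse chart) of \<open>S\<close>.\<close>

definition local_param ::
  "(real ^ ('n::finite + 1)) set \<Rightarrow> (real ^ 'n) set \<Rightarrow> (real ^ 'n \<Rightarrow> real ^ ('n + 1)) \<Rightarrow>
   (real ^ 'n \<Rightarrow> (real ^ 'n) \<Rightarrow>\<^sub>L (real ^ ('n + 1))) \<Rightarrow> bool" where
  "local_param S U \<phi> \<phi>' \<longleftrightarrow>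
     open U \<and> openin (top_of_set S) (\<phi> ` U) \<and> (\<exists>\<psi>. homeomorphism U (\<phi> ` U) \<phi> \<psi>) \<and>
     (\<forall>x\<in>U. (\<phi> has_derivative blinfun_apply (\<phi>' x)) (at x)) \<and> continuous_on U \<phi>' \<and>
     (\<forall>x\<in>U. inj (blinfun_apply (\<phi>' x)))"

text \<open>The coordinate matrix of the metric pulled back from Euclidean space.\<close>

definition metric_matrix :: "((real ^ 'n) \<Rightarrow>\<^sub>L (real ^ ('n::finite + 1))) \<Rightarrow> real ^ 'n ^ 'n" where
  "metric_matrix D = (\<chi> i j. blinfun_apply D (axis i 1) \<bullet> blinfun_apply D (axis j 1))"

text \<open>The Riemannian volume measure is the unique Borel measure on \<open>S\<close> that is given by
  $\sqrt{\det g}\,dx$ in every local parametrisation.\<close>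

definition is_riemannian_volume ::
  "(real ^ ('n::finite + 1)) set \<Rightarrow> (real ^ ('n + 1)) measure \<Rightarrow> bool" where
  "is_riemannian_volume S V \<longleftrightarrow>
     sets V = sets (restrict_space borel S) \<and>
     (\<forall>U \<phi> \<phi>' A. local_param S U \<phi> \<phi>' \<and> A \<in> sets V \<and> A \<subseteq> \<phi> ` U \<longrightarrow>
        emeasure V A =
          (\<integral>\<^sup>+x\<in>(U \<inter> \<phi> -` A). ennreal (sqrt (det (metric_matrix (\<phi>' x)))) \<partial>lborel))"

definition riemannian_volume ::
  "(real ^ ('n::finite + 1)) set \<Rightarrow> (real ^ ('n + 1)) measure" where
  "riemannian_volume S = (THE V. is_riemannian_volume S V)"

text \<open>The Riemannian normal distribution; the parameter \<open>v\<close> is $\sigma^2$.\<close>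

definition riemannian_normal_const ::
  "(real ^ ('n::finite + 1)) set \<Rightarrow> real ^ ('n + 1) \<Rightarrow> real \<Rightarrow> real" where
  "riemannian_normal_const S \<mu> v =
     (\<integral>y. exp (- (geodesic_dist S y \<mu>)\<^sup>2 / (2 * v)) \<partial>(riemannian_volume S))"

definition riemannian_normal_density ::
  "(real ^ ('n::finite + 1)) set \<Rightarrow> real ^ ('n + 1) \<Rightarrow> real \<Rightarrow> real ^ ('n + 1) \<Rightarrow> real" where
  "riemannian_normal_density S \<mu> v y =
     exp (- (geodesic_dist S y \<mu>)\<^sup>2 / (2 * v)) / riemannian_normal_const S \<mu> v"

definition erf :: "complex \<Rightarrow> complex" where
  "erf z = 2 / complex_of_real (sqrt pi) * contour_integral (linepath 0 z) (\<lambda>t. exp (- t\<^sup>2))"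

definition G :: "nat \<Rightarrow> real \<Rightarrow> real \<Rightarrow> complex" where
  "G m v R = (\<i> / 2) ^ m * complex_of_real (sqrt (pi * v / 2)) *
     (\<Sum>j=0..m. of_nat (m choose j) * (- 1) ^ j *
        complex_of_real (exp (- ((real m - 2 * real j)\<^sup>2 * v / 2))) *
        erf (complex_of_real (R / sqrt (2 * v)) +
             complex_of_real (sqrt (v / 2) * (real m - 2 * real j)) * \<i>))"

end

theory Submission
  imports Defs
begin

text \<open>Stereographic projection from \<open>- \<mu>\<close> parametrises all of the sphere but one point over
  $\mathbb{R}^n$, with conformal factor $\lambda(z) = 2 / (1 + |z|^2)$. The push-forward of
  $\lambda^n\,dz$ satisfies the area formula in every local parametrisation $\phi$: the transition
  map $\tau$ into stereographic coordinates is differentiable and injective between open subsets of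
  $\mathbb{R}^n$, $\det g_\phi = (\lambda(\tau)^n \det D\tau)^2$, and the change of variables
  theorem applies. It is the only such measure because the missing point is a null set in the
  parametrisation from \<open>\<mu>\<close>. The geodesic distance to \<open>\<mu>\<close> is $\arccos (y \cdot \mu)$, which in
  the coordinate $z$ equals $2 \arctan |z|$; polar coordinates and this substitution turn
  $\lambda^n\,dz$ into a constant multiple of $\sin^{n-1}\theta\,d\theta$. Finally, \<open>G m v\<close> is an
  antiderivative of $e^{-\theta^2 / 2v} \sin^m \theta$, by writing $\sin^m$ as a sum of
  exponentials and completing the square.\<close>

text \<open>\<open>riemannian_volume\<close> is a definite description that quantifies over all
  local parametrisations, so a measure must be found that is correct in every one of them, and no
  other may be. Stereographic coordinates suit both tasks. They miss a single point, which one
  further chart settles. They are conformal, so the Gram matrix in any chart is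
  \<open>\<lambda>^2\<close> times that of the square matrix of \<open>D\<tau>\<close>; the
  non-square derivative of \<open>\<phi>\<close> never needs a determinant of its own. The power
  \<open>\<lambda>^n\<close> also fits the radial substitution: with
  \<open>r = tan (\<theta> / 2)\<close> one has \<open>\<lambda> r = sin \<theta>\<close> and
  \<open>\<lambda> dr = d\<theta>\<close>, hence
  \<open>\<lambda>^n r^(n-1) dr = sin^(n-1) \<theta> d\<theta>\<close>. The constant in front is the
  area of the unit sphere in \<open>R^n\<close>, contributed by polar coordinates; it enters the
  normalizing constant and cancels from the distribution function. The values of \<open>G\<close>
  are complex, but its increments from 0 are real integrals, and all claims reduce to these.\<close>

unbundle no fps_syntax

subsection \<open>Change of variables for arbitrary finite index types\<close>

text \<open>The library's change of variables theorem needs a well-ordered index type.\<close>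

typedef 'a wo = "UNIV :: 'a set"
  morphisms un_wo mk_wo by simp

instance wo :: (finite) finite
proof
  have "(UNIV :: 'a wo set) = mk_wo ` UNIV"
    using un_wo_inverse by (metis surjI)
  then show "finite (UNIV :: 'a wo set)" by (metis finite finite_imageI)
qed

text \<open>No order on a finite type is canonical, so an arbitrary injection into
  \<open>nat\<close> is chosen and its order pulled back; induction is then inherited from
  \<open>nat\<close>.\<close>

definition wo_key :: "'a::finite wo \<Rightarrow> nat"
  where "wo_key = (SOME f. inj f)"

lemma inj_wo_key: "inj wo_key"
proof -
  have "\<exists>f :: 'a wo \<Rightarrow> nat. inj f"
    using finite_imp_inj_to_nat_seg[of "UNIV :: 'a wo set"] by auto
  then show ?thesis unfolding wo_key_def by (rule someI_ex)
qed

instantiation wo :: (finite) wellorder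
begin

definition less_eq_wo :: "'a wo \<Rightarrow> 'a wo \<Rightarrow> bool"
  where "x \<le> y \<longleftrightarrow> wo_key x \<le> wo_key y"

definition less_wo :: "'a wo \<Rightarrow> 'a wo \<Rightarrow> bool"
  where "x < y \<longleftrightarrow> wo_key x < wo_key y"

instance
proof
  fix P :: "'a wo \<Rightarrow> bool" and a :: "'a wo"
  assume "\<And>x. (\<And>y. y < x \<Longrightarrow> P y) \<Longrightarrow> P x"
  then show "P a" unfolding less_wo_def by (rule measure_induct_rule)
qed (auto simp: less_eq_wo_def less_wo_def dest: injD[OF inj_wo_key])

end

definition to_wo :: "'b ^ 'n \<Rightarrow> 'b ^ 'n wo"
  where "to_wo x = (\<chi> i. x $ un_wo i)"

definition of_wo :: "'b ^ 'n wo \<Rightarrow> 'b ^ 'n"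
  where "of_wo x = (\<chi> i. x $ mk_wo i)"

lemma of_wo_to_wo [simp]: "of_wo (to_wo x) = x"
  by (simp add: to_wo_def of_wo_def vec_eq_iff mk_wo_inverse)

lemma to_wo_of_wo [simp]: "to_wo (of_wo x) = x"
  by (simp add: to_wo_def of_wo_def vec_eq_iff un_wo_inverse)

lemma bij_mk_wo: "bij mk_wo"
  by (rule o_bij[of un_wo]) (auto simp: fun_eq_iff mk_wo_inverse un_wo_inverse)

lemma linear_to_wo: "linear (to_wo :: real ^ 'n::finite \<Rightarrow> _)"
  by (rule linearI) (auto simp: to_wo_def vec_eq_iff)

lemma linear_of_wo: "linear (of_wo :: real ^ 'n::finite wo \<Rightarrow> _)"
  by (rule linearI) (auto simp: of_wo_def vec_eq_iff)

text \<open>In the Leibniz formula, conjugation of permutations by \<open>f\<close> is a bijection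
  that keeps the sign, and each product is reindexed along \<open>inv f\<close>.\<close>

lemma det_reindex:
  fixes A :: "real ^ 'n::finite ^ 'n" and f :: "'n \<Rightarrow> 'm::finite"
  assumes f: "bij f"
  shows "det (\<chi> i j. A $ inv f i $ inv f j) = det A"
proof -
  let ?c = "map_permutation UNIV f"
  have c: "?c p = f \<circ> p \<circ> inv f" for p
    using f by (auto simp: map_permutation_def restrict_id_def fun_eq_iff bij_is_surj)
  have bij: "bij_betw ?c {p. p permutes UNIV} {p. p permutes UNIV}"
  proof (rule bij_betwI[where g = "\<lambda>q. inv f \<circ> q \<circ> f"])
    show "?c \<in> {p. p permutes UNIV} \<rightarrow> {p. p permutes UNIV}"
      using map_permutation_permutes[of f UNIV UNIV] f by auto
    show "(\<lambda>q. inv f \<circ> q \<circ> f) \<in> {p. p permutes UNIV} \<rightarrow> {p. p permutes UNIV}"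
      using f bij_imp_bij_inv[OF f] by (auto intro!: bij_imp_permutes bij_comp dest: permutes_bij)
  qed (use f in \<open>auto simp: c fun_eq_iff bij_is_inj bij_is_surj surj_f_inv_f inv_f_f\<close>)
  have "det (\<chi> i j. A $ inv f i $ inv f j) =
      (\<Sum>p | p permutes UNIV. of_int (sign p) * (\<Prod>i\<in>UNIV. A $ inv f i $ inv f (p i)))"
    by (simp add: det_def)
  also have "\<dots> = (\<Sum>p | p permutes UNIV. of_int (sign (?c p)) * (\<Prod>i\<in>UNIV. A $ inv f i $ inv f (?c p i)))"
    by (rule sum.reindex_bij_betw[OF bij, symmetric])
  also have "\<dots> = det A"
    unfolding det_def
  proof (rule sum.cong[OF refl])
    fix p :: "'n \<Rightarrow> 'n" assume p: "p \<in> {p. p permutes UNIV}"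
    have s: "sign (?c p) = sign p"
      using p f by (intro sign_map_permutation) (auto simp: bij_is_inj)
    have "(\<Prod>i\<in>UNIV. A $ inv f i $ inv f (?c p i)) = (\<Prod>i\<in>UNIV. A $ inv f i $ p (inv f i))"
      using f by (simp add: c bij_is_inj inv_f_f)
    also have "\<dots> = (\<Prod>i\<in>UNIV. A $ i $ p i)"
      by (rule prod.reindex_bij_betw[OF bij_imp_bij_inv[OF f], of "\<lambda>i. A $ i $ p i"])
    finally have "(\<Prod>i\<in>UNIV. A $ inv f i $ inv f (?c p i)) = (\<Prod>i\<in>UNIV. A $ i $ p i)" .
    then show "of_int (sign (?c p)) * (\<Prod>i\<in>UNIV. A $ inv f i $ inv f (?c p i)) =
        of_int (sign p) * (\<Prod>i\<in>UNIV. A $ i $ p i)"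
      by (simp add: s)
  qed
  finally show ?thesis .
qed

lemma inv_mk_wo: "inv mk_wo = un_wo"
  by (rule inv_unique_comp) (auto simp: fun_eq_iff mk_wo_inverse un_wo_inverse)

text \<open>Relabelling coordinates on both sides permutes rows and columns by the same bijection,
  so the Jacobian survives the change of index type.\<close>

lemma det_matrix_wo:
  fixes g :: "real ^ 'n::finite \<Rightarrow> real ^ 'n"
  shows "det (matrix (to_wo \<circ> g \<circ> of_wo)) = det (matrix g)"
proof -
  have "of_wo (axis j 1) = (axis (un_wo j) 1 :: real ^ 'n)" for j
    by (auto simp: of_wo_def axis_def vec_eq_iff mk_wo_inverse un_wo_inverse)
  then have "matrix (to_wo \<circ> g \<circ> of_wo) = (\<chi> i j. matrix g $ inv mk_wo i $ inv mk_wo j)"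
    unfolding vec_eq_iff[of "matrix _"] vec_eq_iff[of "matrix _ $ _"]
    by (simp add: matrix_def to_wo_def inv_mk_wo)
  then show ?thesis
    using det_reindex[OF bij_mk_wo, of "matrix g"] by simp
qed

lemma borel_measurable_to_wo [measurable]: "(to_wo :: real ^ 'n::finite \<Rightarrow> _) \<in> borel_measurable borel"
  by (intro borel_measurable_continuous_onI linear_continuous_on linear_conv_bounded_linear[THEN iffD1] linear_to_wo)

lemma borel_measurable_of_wo [measurable]: "(of_wo :: real ^ 'n::finite wo \<Rightarrow> _) \<in> borel_measurable borel"
  by (intro borel_measurable_continuous_onI linear_continuous_on linear_conv_bounded_linear[THEN iffD1] linear_of_wo)

lemma prod_Basis_vec:
  fixes h :: "real ^ 'n::finite \<Rightarrow> 'c::comm_monoid_mult"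
  shows "(\<Prod>b\<in>Basis. h b) = (\<Prod>i\<in>UNIV. h (axis i 1))"
proof -
  have B: "Basis = range (\<lambda>i. axis i 1 :: real ^ 'n)" by (auto simp: Basis_vec_def)
  moreover have "inj (\<lambda>i. axis i 1 :: real ^ 'n)" by (auto simp: inj_def axis_eq_axis)
  ultimately show ?thesis unfolding B by (subst prod.reindex) simp_all
qed

lemma distr_lborel_to_wo: "distr lborel borel (to_wo :: real ^ 'n::finite \<Rightarrow> _) = lborel"
proof (rule lborel_eqI[symmetric])
  fix l u :: "real ^ 'n wo" assume le: "\<And>b. b \<in> Basis \<Longrightarrow> l \<bullet> b \<le> u \<bullet> b"
  have le': "l $ i \<le> u $ i" for i
    using le[of "axis i 1"] by (simp add: inner_axis)
  have box: "to_wo -` box l u = box (of_wo l) (of_wo u)"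
    by (auto simp: mem_box_cart to_wo_def of_wo_def) (metis un_wo_inverse mk_wo_inverse UNIV_I)+
  have "emeasure (distr lborel borel to_wo) (box l u) = emeasure lborel (box (of_wo l) (of_wo u) :: (real ^ 'n) set)"
    by (subst emeasure_distr) (auto simp: box)
  also have "\<dots> = ennreal (\<Prod>b\<in>Basis. (of_wo u - of_wo l) \<bullet> b)"
    using le' by (intro emeasure_lborel_box) (auto simp: Basis_vec_def inner_axis of_wo_def)
  also have "(\<Prod>b\<in>Basis. (of_wo u - of_wo l) \<bullet> b) = (\<Prod>i\<in>UNIV. (u - l) $ mk_wo i)"
    by (simp add: prod_Basis_vec inner_axis of_wo_def)
  also have "\<dots> = (\<Prod>i\<in>UNIV. (u - l) $ i)"
    by (rule prod.reindex_bij_betw[OF bij_mk_wo])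
  also have "\<dots> = (\<Prod>b\<in>Basis. (u - l) \<bullet> b)"
    by (simp add: prod_Basis_vec inner_axis)
  finally show "emeasure (distr lborel borel to_wo) (box l u) = (\<Prod>b\<in>Basis. (u - l) \<bullet> b)" .
qed simp

text \<open>Lebesgue measurability is the right generality here: the Jacobian comes from an
  arbitrary choice of derivatives, and \<open>nn_integral_change_of_variables_wo\<close> yields only
  this much for it. The integral is transferred through a Borel function equal to \<open>f\<close>
  almost everywhere.\<close>

lemma nn_integral_to_wo:
  fixes f :: "real ^ 'n::finite wo \<Rightarrow> ennreal"
  assumes "f \<in> borel_measurable lebesgue"
  shows "(\<integral>\<^sup>+x. f (to_wo x) \<partial>lborel) = (\<integral>\<^sup>+x. f x \<partial>lborel)"
proof -
  obtain f' where f': "f' \<in> borel_measurable lborel" "AE x in lborel. f x = f' x"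
    using completion_ex_borel_measurable[of f lborel] assms by auto
  have "AE x in lborel. f (to_wo x) = f' (to_wo x :: real ^ 'n wo)"
  proof -
    have "AE x in distr lborel borel (to_wo :: real ^ 'n \<Rightarrow> _). f x = f' x"
      unfolding distr_lborel_to_wo using f'(2) .
    then show ?thesis by (rule AE_distrD[rotated]) simp
  qed
  then have "(\<integral>\<^sup>+x. f (to_wo x) \<partial>lborel) = (\<integral>\<^sup>+x. f' (to_wo x :: real ^ 'n wo) \<partial>lborel)"
    by (rule nn_integral_cong_AE)
  also have "\<dots> = (\<integral>\<^sup>+x. f' x \<partial>distr lborel borel (to_wo :: real ^ 'n \<Rightarrow> _))"
    using f' by (intro nn_integral_distr[symmetric]) auto
  also have "\<dots> = (\<integral>\<^sup>+x. f x \<partial>lborel)"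
    unfolding distr_lborel_to_wo using f' by (intro nn_integral_cong_AE) auto
  finally show ?thesis .
qed

text \<open>The measurability conclusion is recorded so that the Jacobian integrand can afterwards
  be moved through \<open>nn_integral_to_wo\<close>.\<close>

lemma nn_integral_change_of_variables_wo:
  fixes f :: "real ^ 'n::{finite,wellorder} \<Rightarrow> real" and g :: "real ^ 'n::_ \<Rightarrow> real ^ 'n::_"
  assumes S: "S \<in> sets lebesgue"
    and der: "\<And>x. x \<in> S \<Longrightarrow> (g has_derivative g' x) (at x within S)"
    and inj: "inj_on g S" and f: "\<And>x. f x \<ge> 0" and int: "f absolutely_integrable_on (g ` S)"
  shows "(\<lambda>x. \<bar>det (matrix (g' x))\<bar> * f (g x) * indicator S x) \<in> borel_measurable lebesgue"
    and "(\<integral>\<^sup>+x\<in>S. ennreal (\<bar>det (matrix (g' x))\<bar> * f (g x)) \<partial>lborel) = (\<integral>\<^sup>+y\<in>g ` S. ennreal (f y) \<partial>lborel)"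
proof -
  let ?D = "\<lambda>x. \<bar>det (matrix (g' x))\<bar> * f (g x)"
  \<comment> \<open>The theorem applied here speaks of vector-valued integrands, so \<open>f\<close>
    is viewed as a map into \<open>real ^ 1\<close>; the equivalence is then used from right to
    left.\<close>
  have "(\<lambda>x. \<bar>det (matrix (g' x))\<bar> *\<^sub>R vec (f (g x)) :: real ^ 1) absolutely_integrable_on S \<and>
           integral S (\<lambda>x. \<bar>det (matrix (g' x))\<bar> *\<^sub>R vec (f (g x))) = (vec (integral (g ` S) f) :: real ^ 1)
         \<longleftrightarrow> (\<lambda>x. vec (f x) :: real ^ 1) absolutely_integrable_on (g ` S) \<and>
           integral (g ` S) (\<lambda>x. vec (f x)) = (vec (integral (g ` S) f) :: real ^ 1)"
    by (intro has_absolute_integral_change_of_variables assms) auto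
  then have D: "?D absolutely_integrable_on S" "integral S ?D = integral (g ` S) f"
    using int by (auto simp: absolutely_integrable_on_1_iff integral_on_1_eq)
  have D': "(?D has_integral integral (g ` S) f) S" "(f has_integral integral (g ` S) f) (g ` S)"
    using D int by (auto simp: absolutely_integrable_on_def has_integral_iff)
  have "(\<lambda>x. indicator S x *\<^sub>R ?D x) \<in> borel_measurable lebesgue"
    using D'(1) by (rule has_integral_implies_lebesgue_measurable)
  then show "(\<lambda>x. ?D x * indicator S x) \<in> borel_measurable lebesgue"
    by (simp add: mult.commute)
  show "(\<integral>\<^sup>+x\<in>S. ennreal (?D x) \<partial>lborel) = (\<integral>\<^sup>+y\<in>g ` S. ennreal (f y) \<partial>lborel)"
    using nn_integral_has_integral_lebesgue'[OF _ D'(1)] nn_integral_has_integral_lebesgue'[OF _ D'(2)] f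
    by simp
qed

text \<open>Conjugating \<open>g\<close> by the coordinate relabelling reduces this to a
  well-ordered index type. The finite integral of \<open>f\<close> supplies absolute integrability
  on the image.\<close>

proposition nn_integral_change_of_variables:
  fixes f :: "real ^ 'n::finite \<Rightarrow> real" and g :: "real ^ 'n \<Rightarrow> real ^ 'n"
  assumes S: "S \<in> sets borel"
    and der: "\<And>x. x \<in> S \<Longrightarrow> (g has_derivative g' x) (at x within S)"
    and inj: "inj_on g S" and gS: "g ` S \<in> sets borel"
    and f: "\<And>x. f x \<ge> 0" "f \<in> borel_measurable borel" "(\<integral>\<^sup>+y. ennreal (f y) \<partial>lborel) < \<infinity>"
  shows "(\<integral>\<^sup>+x\<in>S. ennreal (\<bar>det (matrix (g' x))\<bar> * f (g x)) \<partial>lborel) = (\<integral>\<^sup>+y\<in>g ` S. ennreal (f y) \<partial>lborel)"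
proof -
  note [measurable] = S gS f(2)
  define T where "T = of_wo -` S"
  define h where "h = to_wo \<circ> g \<circ> of_wo"
  define h' where "h' = (\<lambda>x. to_wo \<circ> g' (of_wo x) \<circ> of_wo)"
  have T: "T \<in> sets borel" unfolding T_def using measurable_sets[OF borel_measurable_of_wo S] by simp
  have T_eq: "T = to_wo ` S" unfolding T_def by (force intro: image_eqI[of _ _ "of_wo _"])
  have hT: "h ` T = of_wo -` (g ` S)"
  proof -
    have "h ` T = to_wo ` g ` S" by (simp add: h_def T_eq image_image)
    also have "\<dots> = of_wo -` (g ` S)" by (force intro: image_eqI[of _ _ "of_wo _"])
    finally show ?thesis .
  qed
  have hT': "h ` T \<in> sets borel" unfolding hT using measurable_sets[OF borel_measurable_of_wo gS] by simp
  have "integrable lborel (\<lambda>x. f (of_wo x) * indicator (h ` T) x)"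
  proof (rule integrableI_nonneg)
    have "(\<integral>\<^sup>+x. ennreal (f (of_wo x) * indicator (h ` T) x) \<partial>lborel) \<le> (\<integral>\<^sup>+x. ennreal (f (of_wo x)) \<partial>lborel)"
      using f by (intro nn_integral_mono) (auto split: split_indicator)
    also have "\<dots> = (\<integral>\<^sup>+x. ennreal (f (of_wo (to_wo x))) \<partial>lborel)"
      by (rule nn_integral_to_wo[symmetric]) (auto intro!: measurable_completion)
    finally show "(\<integral>\<^sup>+x. ennreal (f (of_wo x) * indicator (h ` T) x) \<partial>lborel) < \<infinity>"
      using f by (auto simp: less_top[symmetric] top_unique)
  qed (use f hT' in auto)
  then have int: "(f \<circ> of_wo) absolutely_integrable_on (h ` T)"
    unfolding set_integrable_def
    by (subst integrable_completion) (use hT' in \<open>auto simp: mult.commute\<close>)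
  have der': "(h has_derivative h' x) (at x within T)" if "x \<in> T" for x
  proof -
    have 1: "(of_wo has_derivative of_wo) (at x within T)"
      by (intro linear_imp_has_derivative linear_of_wo)
    have 2: "(g has_derivative g' (of_wo x)) (at (of_wo x) within of_wo ` T)"
      using der[of "of_wo x"] that by (auto simp: T_eq image_image)
    have 3: "(to_wo has_derivative to_wo) (at ((g \<circ> of_wo) x) within (g \<circ> of_wo) ` T)"
      by (intro linear_imp_has_derivative linear_to_wo)
    from diff_chain_within[OF diff_chain_within[OF 1 2] 3]
    show ?thesis by (simp add: h_def h'_def o_assoc comp_def)
  qed
  have injh: "inj_on h T"
    unfolding h_def T_eq using inj by (auto simp: inj_on_def) (metis of_wo_to_wo)
  note cov = nn_integral_change_of_variables_wo[OF sets_completionI_sets der' injh _ int]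
  have "(\<integral>\<^sup>+x\<in>S. ennreal (\<bar>det (matrix (g' x))\<bar> * f (g x)) \<partial>lborel) =
      (\<integral>\<^sup>+x. ennreal (\<bar>det (matrix (h' (to_wo x)))\<bar> * (f \<circ> of_wo) (h (to_wo x)) * indicator T (to_wo x)) \<partial>lborel)"
    by (intro nn_integral_cong) (auto simp: h'_def h_def det_matrix_wo T_def split: split_indicator)
  also have "\<dots> = (\<integral>\<^sup>+x. ennreal (\<bar>det (matrix (h' x))\<bar> * (f \<circ> of_wo) (h x) * indicator T x) \<partial>lborel)"
    by (rule nn_integral_to_wo) (use cov(1) T f in auto)
  also have "\<dots> = (\<integral>\<^sup>+x\<in>T. ennreal (\<bar>det (matrix (h' x))\<bar> * (f \<circ> of_wo) (h x)) \<partial>lborel)"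
    by (intro nn_integral_cong) (auto split: split_indicator)
  also have "\<dots> = (\<integral>\<^sup>+y\<in>h ` T. ennreal ((f \<circ> of_wo) y) \<partial>lborel)"
    using T f by (intro cov(2)) auto
  also have "\<dots> = (\<integral>\<^sup>+y. ennreal ((f \<circ> of_wo) (to_wo y)) * indicator (h ` T) (to_wo y) \<partial>lborel)"
    using hT' by (intro nn_integral_to_wo[symmetric] measurable_completion) auto
  also have "\<dots> = (\<integral>\<^sup>+y\<in>g ` S. ennreal (f y) \<partial>lborel)"
    by (intro nn_integral_cong) (auto simp: hT split: split_indicator)
  finally show ?thesis .
qed

subsection \<open>The functions erf and G\<close>

text \<open>The integrand is entire, hence has a primitive on the whole plane, and the integral
  along the segment from 0 is an increment of that primitive.\<close>

lemma erf_has_field_derivative: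
  "(erf has_field_derivative 2 / complex_of_real (sqrt pi) * exp (- z\<^sup>2)) (at z)"
proof -
  have "(\<lambda>t::complex. exp (- t\<^sup>2)) holomorphic_on UNIV"
    by (intro holomorphic_intros)
  then obtain g where g: "(g has_field_derivative exp (- x\<^sup>2)) (at x within UNIV)" for x :: complex
    using holomorphic_convex_primitive'[of UNIV "\<lambda>t. exp (- t\<^sup>2)"] by auto
  have "contour_integral (linepath 0 w) (\<lambda>t. exp (- t\<^sup>2)) = g w - g 0" for w
    using contour_integral_primitive[of UNIV g "\<lambda>t. exp (- t\<^sup>2)" "linepath 0 w"] g
    by (intro contour_integral_unique) auto
  then have erf_eq: "erf = (\<lambda>w. 2 / complex_of_real (sqrt pi) * (g w - g 0))"
    by (simp add: erf_def fun_eq_iff)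
  have "((\<lambda>w. 2 / complex_of_real (sqrt pi) * (g w - g 0)) has_field_derivative
      2 / complex_of_real (sqrt pi) * (exp (- z\<^sup>2) - 0)) (at z)"
    by (intro DERIV_cmult DERIV_diff g DERIV_const)
  then show ?thesis by (simp only: erf_eq diff_zero)
qed

text \<open>Source of the coefficients of \<open>G\<close>: the binomial theorem applied to
  \<open>sin x = (i / 2) (exp (-ix) - exp (ix))\<close>, where the term with index \<open>j\<close>
  carries the frequency \<open>(m - j) - j = m - 2j\<close>.\<close>

lemma sin_power_eq_sum:
  "complex_of_real (sin x ^ m) =
    (\<i> / 2) ^ m * (\<Sum>j=0..m. of_nat (m choose j) * (- 1) ^ j * exp (- (\<i> * of_real ((real m - 2 * real j) * x))))"
proof -
  let ?e = "exp (\<i> * of_real x)"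
  have s: "complex_of_real (sin x) = \<i> / 2 * (- ?e + inverse ?e)"
    by (simp add: sin_of_real[symmetric] sin_exp_eq exp_minus field_simps)
  have "complex_of_real (sin x ^ m) = (\<i> / 2) ^ m * (- ?e + inverse ?e) ^ m"
    unfolding of_real_power s power_mult_distrib ..
  also have "(- ?e + inverse ?e) ^ m = (\<Sum>j\<le>m. of_nat (m choose j) * (- ?e) ^ j * inverse ?e ^ (m - j))"
    by (rule binomial_ring)
  also have "\<dots> = (\<Sum>j\<le>m. of_nat (m choose j) * (- 1) ^ j * exp (- (\<i> * of_real ((real m - 2 * real j) * x))))"
  proof (rule sum.cong[OF refl])
    fix j assume "j \<in> {..m}"
    then have j: "complex_of_nat (m - j) = complex_of_nat m - complex_of_nat j" by auto
    have "(- ?e) ^ j * inverse ?e ^ (m - j) = (- 1) ^ j * (?e ^ j * inverse ?e ^ (m - j))"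
      by (subst power_minus) (simp add: mult_ac)
    moreover have "?e ^ j = exp (of_nat j * (\<i> * of_real x))"
      by (rule exp_of_nat_mult[symmetric])
    moreover have "inverse ?e ^ (m - j) = exp (of_nat (m - j) * (- (\<i> * of_real x)))"
      by (subst exp_of_nat_mult) (simp add: exp_minus)
    moreover have "exp (of_nat j * (\<i> * of_real x)) * exp (of_nat (m - j) * (- (\<i> * of_real x))) =
        exp (- (\<i> * of_real ((real m - 2 * real j) * x)))"
      unfolding mult_exp_exp j by (rule arg_cong[of _ _ exp]) (simp add: algebra_simps)
    ultimately have "(- ?e) ^ j * inverse ?e ^ (m - j) =
        (- 1) ^ j * exp (- (\<i> * of_real ((real m - 2 * real j) * x)))"
      by metis
    then show "of_nat (m choose j) * (- ?e) ^ j * inverse ?e ^ (m - j) =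
        of_nat (m choose j) * (- 1) ^ j * exp (- (\<i> * of_real ((real m - 2 * real j) * x)))"
      by (simp only: mult.assoc)
  qed
  finally show ?thesis by (simp add: atMost_atLeast0)
qed

lemma G_has_vector_derivative:
  assumes v: "v > 0"
  shows "((\<lambda>R. G m v R) has_vector_derivative complex_of_real (exp (- R\<^sup>2 / (2 * v)) * sin R ^ m)) (at R)"
proof -
  define k where "k = (\<lambda>j. real m - 2 * real j)"
  define a where "a = complex_of_real (1 / sqrt (2 * v))"
  define w where "w = (\<lambda>j R. complex_of_real (R / sqrt (2 * v)) + complex_of_real (sqrt (v / 2) * k j) * \<i>)"
  have w_eq: "w j R = a * of_real R + complex_of_real (sqrt (v / 2) * k j) * \<i>" for j R
    by (simp add: w_def a_def)
  have erf_deriv: "((\<lambda>R. erf (w j R)) has_vector_derivative a * (2 / complex_of_real (sqrt pi) * exp (- (w j R)\<^sup>2))) (at R)" for j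
  proof -
    have "((\<lambda>R. w j R) has_vector_derivative a) (at R)"
      unfolding w_eq has_vector_derivative_def
      by (auto intro!: derivative_eq_intros simp: scaleR_conv_of_real)
    from field_vector_diff_chain_at[OF this erf_has_field_derivative] show ?thesis
      by (simp add: o_def)
  qed
  let ?D = "(\<i> / 2) ^ m * complex_of_real (sqrt (pi * v / 2)) *
     (\<Sum>j=0..m. of_nat (m choose j) * (- 1) ^ j * complex_of_real (exp (- ((k j)\<^sup>2 * v / 2))) *
        (a * (2 / complex_of_real (sqrt pi) * exp (- (w j R)\<^sup>2))))"
  have G_eq: "G m v = (\<lambda>R. (\<i> / 2) ^ m * complex_of_real (sqrt (pi * v / 2)) *
     (\<Sum>j=0..m. of_nat (m choose j) * (- 1) ^ j * complex_of_real (exp (- ((k j)\<^sup>2 * v / 2))) * erf (w j R)))"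
    by (simp add: G_def k_def w_def fun_eq_iff)
  have "((\<lambda>R. G m v R) has_vector_derivative ?D) (at R)"
    unfolding G_eq
    by (intro has_vector_derivative_mult_right has_vector_derivative_sum erf_deriv)
  also have "?D = complex_of_real (exp (- R\<^sup>2 / (2 * v)) * sin R ^ m)"
  proof -
    \<comment> \<open>The prefactor \<open>sqrt (pi * v / 2)\<close> of \<open>G\<close> cancels the
      \<open>2 / sqrt pi\<close> of \<open>erf\<close> together with the inner derivative
      \<open>1 / sqrt (2 * v)\<close>.\<close>
    have c: "complex_of_real (sqrt (pi * v / 2)) * (a * (2 / complex_of_real (sqrt pi))) = 1"
    proof -
      have "sqrt (pi * v / 2) * (1 / sqrt (2 * v) * (2 / sqrt pi)) = 1"
      proof -
        have eq: "sqrt (pi * v / 2) = sqrt pi * sqrt v / sqrt 2" "sqrt (2 * v) = sqrt 2 * sqrt v"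
          by (simp_all only: real_sqrt_mult real_sqrt_divide)
        show ?thesis unfolding eq using v by (simp add: field_simps)
      qed
      then have "complex_of_real (sqrt (pi * v / 2) * (1 / sqrt (2 * v) * (2 / sqrt pi))) = 1"
        by (simp only: of_real_1)
      then show ?thesis
        unfolding a_def by (simp only: of_real_mult of_real_divide of_real_numeral)
    qed
    \<comment> \<open>Completing the square: \<open>(w j R)\<^sup>2\<close> is
      \<open>R\<^sup>2 / (2 * v) - (k j)\<^sup>2 * v / 2 + \<i> * k j * R\<close>, and the Gaussian
      weight in \<open>G\<close> removes the middle term.\<close>
    have w2: "complex_of_real (exp (- ((k j)\<^sup>2 * v / 2))) * exp (- (w j R)\<^sup>2) =
        complex_of_real (exp (- R\<^sup>2 / (2 * v))) * exp (- (\<i> * of_real (k j * R)))" for j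
    proof -
      have "sqrt (v / 2) / sqrt (2 * v) = 1 / 2"
        using v by (simp add: real_sqrt_divide real_sqrt_mult field_simps)
      then have "2 * (R / sqrt (2 * v)) * (sqrt (v / 2) * k j) = R * k j"
        by (simp add: field_simps)
      then have *: "2 * complex_of_real (R / sqrt (2 * v)) * complex_of_real (sqrt (v / 2) * k j) = of_real (R * k j)"
        by (metis of_real_mult of_real_numeral)
      have "(w j R)\<^sup>2 = of_real ((R / sqrt (2 * v))\<^sup>2) - of_real ((sqrt (v / 2) * k j)\<^sup>2) + \<i> * of_real (R * k j)"
        unfolding w_def *[symmetric] of_real_power by (simp add: power2_eq_square algebra_simps)
      also have "(R / sqrt (2 * v))\<^sup>2 = R\<^sup>2 / (2 * v)" using v by (simp add: power_divide)
      also have "(sqrt (v / 2) * k j)\<^sup>2 = (k j)\<^sup>2 * v / 2" using v by (simp add: power_mult_distrib)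
      finally have "of_real (- ((k j)\<^sup>2 * v / 2)) + - (w j R)\<^sup>2 =
          complex_of_real (- R\<^sup>2 / (2 * v)) + - (\<i> * of_real (k j * R))"
        by (simp add: mult.commute)
      then show ?thesis
        unfolding exp_of_real[symmetric] mult_exp_exp by (rule arg_cong)
    qed
    have "?D = (\<i> / 2) ^ m * (complex_of_real (sqrt (pi * v / 2)) * (a * (2 / complex_of_real (sqrt pi)))) *
     (\<Sum>j=0..m. of_nat (m choose j) * (- 1) ^ j * (complex_of_real (exp (- ((k j)\<^sup>2 * v / 2))) * exp (- (w j R)\<^sup>2)))"
      by (simp add: sum_distrib_left mult_ac)
    also have "\<dots> = complex_of_real (exp (- R\<^sup>2 / (2 * v))) *
      ((\<i> / 2) ^ m * (\<Sum>j=0..m. of_nat (m choose j) * (- 1) ^ j * exp (- (\<i> * of_real (k j * R)))))"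
      unfolding c w2 by (simp add: sum_distrib_left mult_ac)
    also have "\<dots> = complex_of_real (exp (- R\<^sup>2 / (2 * v)) * sin R ^ m)"
      by (simp only: sin_power_eq_sum of_real_mult k_def)
    finally show ?thesis .
  qed
  finally show ?thesis .
qed

lemma G_diff_eq_integral:
  assumes "v > 0" "0 \<le> R"
  shows "G m v R - G m v 0 = complex_of_real (integral {0..R} (\<lambda>r. exp (- r\<^sup>2 / (2 * v)) * sin r ^ m))"
proof -
  let ?f = "\<lambda>r. exp (- r\<^sup>2 / (2 * v)) * sin r ^ m"
  have "((\<lambda>r. complex_of_real (?f r)) has_integral G m v R - G m v 0) {0..R}"
    using assms by (intro fundamental_theorem_of_calculus has_vector_derivative_at_within[OF G_has_vector_derivative]) auto
  moreover have "(?f has_integral integral {0..R} ?f) {0..R}"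
    using assms by (intro integrable_integral integrable_continuous_real continuous_intros) auto
  then have "((\<lambda>r. complex_of_real (?f r)) has_integral complex_of_real (integral {0..R} ?f)) {0..R}"
    by (rule has_integral_of_real)
  ultimately show ?thesis
    by (rule has_integral_unique)
qed

subsection \<open>Geodesic distance on the sphere\<close>

text \<open>Brings \<open>valid_path\<close> into the shape required by the fundamental theorem of
  calculus with finitely many exceptional points.\<close>

lemma piecewise_C1_has_vector_derivative:
  assumes "valid_path \<gamma>"
  obtains K where "finite K" "continuous_on {0..1} \<gamma>"
    "\<And>t. t \<in> {0..1} - K \<Longrightarrow> (\<gamma> has_vector_derivative vector_derivative \<gamma> (at t)) (at t)"
proof -
  obtain K where "finite K" "\<gamma> C1_differentiable_on {0..1} - K" "continuous_on {0..1} \<gamma>"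
    using assms by (auto simp: valid_path_def piecewise_C1_differentiable_on_def)
  then show ?thesis
    using that by (auto simp: C1_differentiable_on_eq vector_derivative_works)
qed

text \<open>The arc cosine of the height \<open>\<gamma> t \<bullet> q\<close> is not differentiable where the curve passes
  through \<open>q\<close> or its antipode; scaling the height by \<open>c < 1\<close> avoids this, and the factor
  disappears in the limit.\<close>

lemma length_ge_arccos:
  fixes \<gamma> :: "real \<Rightarrow> 'a::euclidean_space"
  assumes \<gamma>: "valid_path \<gamma>" "path_image \<gamma> \<subseteq> sphere 0 1" "pathstart \<gamma> = p" "pathfinish \<gamma> = q"
    and L: "((\<lambda>t. norm (vector_derivative \<gamma> (at t))) has_integral L) {0..1}"
  shows "arccos (p \<bullet> q) \<le> L"
proof -
  obtain K where K: "finite K" "continuous_on {0..1} \<gamma>"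
    and der: "\<And>t. t \<in> {0..1} - K \<Longrightarrow> (\<gamma> has_vector_derivative vector_derivative \<gamma> (at t)) (at t)"
    using piecewise_C1_has_vector_derivative[OF \<gamma>(1)] by blast
  have unit: "norm (\<gamma> t) = 1" if "t \<in> {0..1}" for t
    using \<gamma>(2) that by (force simp: path_image_def image_subset_iff)
  have ends: "\<gamma> 0 = p" "\<gamma> 1 = q" using \<gamma> by (auto simp: pathstart_def pathfinish_def)
  have q: "norm q = 1" using unit[of 1] ends by simp
  define u where "u = (\<lambda>t. \<gamma> t \<bullet> q)"
  have u_le: "\<bar>u t\<bar> \<le> 1" if "t \<in> {0..1}" for t
    using Cauchy_Schwarz_ineq2[of "\<gamma> t" q] unit[OF that] q by (simp add: u_def)
  \<comment> \<open>At the end of the curve the scaled height is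
    \<open>c * (q \<bullet> q) = c\<close>; this is the origin of the correction
    \<open>arccos c\<close>, which vanishes as \<open>c\<close> tends to 1.\<close>
  have step: "arccos (c * (p \<bullet> q)) - arccos c \<le> L" if c: "0 < c" "c < 1" for c
  proof -
    have cu: "\<bar>c * u t\<bar> < 1" if "t \<in> {0..1}" for t
      using u_le[OF that] c by (simp add: abs_mult) (smt (verit) mult_left_le)
    define D where "D = (\<lambda>t. inverse (- sqrt (1 - (c * u t)\<^sup>2)) * (c * (vector_derivative \<gamma> (at t) \<bullet> q)))"
    have int_D: "((\<lambda>t. D t) has_integral arccos (c * u 1) - arccos (c * u 0)) {0..1}"
    proof (rule fundamental_theorem_of_calculus_interior_strong[OF K(1)])
      show "continuous_on {0..1} (\<lambda>t. arccos (c * u t))"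
      proof (rule continuous_on_arccos)
        show "continuous_on {0..1} (\<lambda>t. c * u t)"
          unfolding u_def by (intro continuous_intros K(2))
        show "\<forall>t\<in>{0..1}. - 1 \<le> c * u t \<and> c * u t \<le> 1"
          using cu by (auto simp: abs_less_iff less_imp_le minus_less_iff intro: less_imp_le)
      qed
      fix t assume t: "t \<in> {0<..<1} - K"
      then have t': "t \<in> {0..1} - K" by auto
      have "((\<lambda>t. c * u t) has_field_derivative c * (vector_derivative \<gamma> (at t) \<bullet> q)) (at t)"
        unfolding has_real_derivative_iff_has_vector_derivative u_def
        by (intro has_vector_derivative_mult_right
            bounded_linear.has_vector_derivative[OF bounded_linear_inner_left der[OF t']])
      moreover have "(arccos has_field_derivative inverse (- sqrt (1 - (c * u t)\<^sup>2))) (at (c * u t))"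
        using cu[of t] t by (intro DERIV_arccos) auto
      ultimately show "((\<lambda>t. arccos (c * u t)) has_vector_derivative D t) (at t)"
        unfolding D_def has_real_derivative_iff_has_vector_derivative[symmetric]
        by (rule DERIV_chain2[rotated])
    qed simp
    then have D: "((\<lambda>t. - D t) has_integral arccos (c * u 0) - arccos (c * u 1)) {0..1}"
      using has_integral_neg[OF int_D] by simp
    \<comment> \<open>The curve stays on the sphere, so its velocity is orthogonal to
      \<open>\<gamma> t\<close>. Only the component of \<open>q\<close> orthogonal to
      \<open>\<gamma> t\<close>, of length \<open>sqrt (1 - (u t)\<^sup>2)\<close>, contributes to
      the derivative of the height, and this length is at most the root that occurs in
      \<open>D\<close>.\<close>
    have bound: "- D t \<le> norm (vector_derivative \<gamma> (at t))" if t: "t \<in> {0<..<1} - K" for t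
    proof -
      let ?d = "vector_derivative \<gamma> (at t)"
      have t': "t \<in> {0..1} - K" "t \<in> {0..1}" using t by auto
      have "((\<lambda>s. \<gamma> s \<bullet> \<gamma> s) has_vector_derivative \<gamma> t \<bullet> ?d + ?d \<bullet> \<gamma> t) (at t)"
        by (rule bounded_bilinear.has_vector_derivative[OF bounded_bilinear_inner der[OF t'(1)] der[OF t'(1)]])
      moreover have "((\<lambda>s. \<gamma> s \<bullet> \<gamma> s) has_vector_derivative 0) (at t)"
      proof (rule has_vector_derivative_transform_within_open[OF has_vector_derivative_const])
        show "1 = \<gamma> s \<bullet> \<gamma> s" if "s \<in> {0<..<1}" for s
          using unit[of s] that by (simp add: dot_square_norm)
      qed (use t in auto)
      ultimately have orth: "?d \<bullet> \<gamma> t = 0"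
        by (auto dest: vector_derivative_unique_at simp: inner_commute)
      have "\<bar>?d \<bullet> q\<bar> = \<bar>?d \<bullet> (q - u t *\<^sub>R \<gamma> t)\<bar>"
        by (simp add: inner_diff_right orth)
      also have "\<dots> \<le> norm ?d * norm (q - u t *\<^sub>R \<gamma> t)"
        by (rule Cauchy_Schwarz_ineq2)
      also have "norm (q - u t *\<^sub>R \<gamma> t) = sqrt (1 - (u t)\<^sup>2)"
      proof (rule real_sqrt_unique[symmetric])
        have "\<gamma> t \<bullet> \<gamma> t = 1" "q \<bullet> q = 1"
          using q unit[OF t'(2)] by (simp_all add: dot_square_norm)
        then show "(norm (q - u t *\<^sub>R \<gamma> t))\<^sup>2 = 1 - (u t)\<^sup>2"
          unfolding power2_norm_eq_inner
          by (simp add: inner_diff_left inner_diff_right u_def inner_commute[of q "\<gamma> t"] power2_eq_square)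
      qed simp
      finally have 1: "\<bar>?d \<bullet> q\<bar> \<le> norm ?d * sqrt (1 - (u t)\<^sup>2)" .
      have pos: "0 < sqrt (1 - (c * u t)\<^sup>2)"
        using cu[OF t'(2)] by (simp add: abs_square_less_1)
      have "(c * u t)\<^sup>2 \<le> (u t)\<^sup>2"
        using c by (simp add: power_mult_distrib mult_left_le_one_le power_le_one)
      then have 2: "sqrt (1 - (u t)\<^sup>2) \<le> sqrt (1 - (c * u t)\<^sup>2)"
        by simp
      have "c * (?d \<bullet> q) \<le> \<bar>?d \<bullet> q\<bar>"
        using c by (smt (verit) mult_left_le_one_le mult_nonneg_nonpos)
      also have "\<dots> \<le> norm ?d * sqrt (1 - (c * u t)\<^sup>2)"
        using 1 mult_left_mono[OF 2, of "norm ?d"] by simp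
      finally show ?thesis
        using pos by (simp add: D_def field_simps)
    qed
    have "arccos (c * u 0) - arccos (c * u 1) \<le> L"
    proof (rule has_integral_le)
      \<comment> \<open>The pointwise bound is available only off the end points and
        \<open>K\<close>, so both integrands are set to 0 on this finite set.\<close>
      show "((\<lambda>t. if t \<in> {0, 1} \<union> K then 0 else - D t) has_integral arccos (c * u 0) - arccos (c * u 1)) {0..1}"
        by (rule has_integral_spike_finite[OF _ _ D, of "{0, 1} \<union> K"]) (use K in auto)
      show "((\<lambda>t. if t \<in> {0, 1} \<union> K then 0 else norm (vector_derivative \<gamma> (at t))) has_integral L) {0..1}"
        by (rule has_integral_spike_finite[OF _ _ L, of "{0, 1} \<union> K"]) (use K in auto)
    qed (use bound in force)
    then show ?thesis
      using q by (simp add: u_def ends dot_square_norm)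
  qed
  have pq: "\<bar>p \<bullet> q\<bar> \<le> 1" using u_le[of 0] by (simp add: u_def ends)
  have "((\<lambda>c. arccos (c * (p \<bullet> q)) - arccos c) \<longlongrightarrow> arccos (1 * (p \<bullet> q)) - arccos 1) (at_left 1)"
  proof -
    have c_in: "\<forall>\<^sub>F c in at_left (1::real). c \<in> {0<..<1}"
      by (rule eventually_at_leftI[of 0]) auto
    have cont: "continuous_on {-1..1} arccos" by (rule continuous_on_arccos')
    have lim: "((\<lambda>c. arccos (f c)) \<longlongrightarrow> arccos (f 1)) (at_left 1)"
      if "(f \<longlongrightarrow> f 1) (at_left 1)" "\<And>c. c \<in> {0<..1} \<Longrightarrow> f c \<in> {-1..1}" for f :: "real \<Rightarrow> real"
      by (rule continuous_on_tendsto_compose[OF cont that(1)])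
        (use that(2) in \<open>auto intro: eventually_mono[OF c_in]\<close>)
    have bound: "c * (p \<bullet> q) \<in> {-1..1}" if "c \<in> {0<..1}" for c
    proof -
      have "\<bar>c * (p \<bullet> q)\<bar> \<le> 1"
        using that pq mult_le_one[of c "\<bar>p \<bullet> q\<bar>"] by (simp add: abs_mult)
      then show ?thesis by (auto simp: abs_le_iff)
    qed
    have "((\<lambda>c. arccos (c * (p \<bullet> q))) \<longlongrightarrow> arccos (1 * (p \<bullet> q))) (at_left 1)"
      by (rule lim[of "\<lambda>c. c * (p \<bullet> q)"]) (intro tendsto_intros, rule bound)
    moreover have "(arccos \<longlongrightarrow> arccos 1) (at_left 1)"
      by (rule lim[of "\<lambda>c. c"]) (intro tendsto_intros, auto)
    ultimately show ?thesis by (rule tendsto_diff)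
  qed
  moreover have "\<forall>\<^sub>F c in at_left 1. arccos (c * (p \<bullet> q)) - arccos c \<le> L"
    by (rule eventually_at_leftI[of 0]) (use step in auto)
  ultimately have "arccos (1 * (p \<bullet> q)) - arccos 1 \<le> L"
    by (rule tendsto_upperbound) simp
  then show ?thesis by simp
qed

text \<open>The lower bound of \<open>length_ge_arccos\<close> is attained by an arc of the great
  circle through \<open>p\<close> and \<open>q\<close>, so the infimum is a minimum.\<close>

lemma geodesic_dist_sphere:
  fixes p q :: "'a::euclidean_space"
  assumes dim: "DIM('a) \<ge> 2" and p: "norm p = 1" and q: "norm q = 1"
  shows "geodesic_dist (sphere 0 1) p q = arccos (p \<bullet> q)"
proof -
  define \<theta> where "\<theta> = arccos (p \<bullet> q)"
  have pq: "\<bar>p \<bullet> q\<bar> \<le> 1" using Cauchy_Schwarz_ineq2[of p q] p q by simp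
  have \<theta>: "cos \<theta> = p \<bullet> q" "0 \<le> \<theta>" "\<theta> \<le> pi"
    using pq arccos_lbound[of "p \<bullet> q"] arccos_ubound[of "p \<bullet> q"] by (auto simp: \<theta>_def abs_le_iff)
  \<comment> \<open>\<open>w\<close> is the unit tangent at \<open>q\<close> that points towards
    \<open>p\<close>. If \<open>p\<close> is \<open>q\<close> or \<open>- q\<close> this direction
    is undetermined, and any unit vector orthogonal to \<open>q\<close> serves; dimension at least 2
    provides one.\<close>
  obtain w where w: "norm w = 1" "w \<bullet> q = 0" "p = cos \<theta> *\<^sub>R q + sin \<theta> *\<^sub>R w"
  proof (cases "p = cos \<theta> *\<^sub>R q")
    case True
    obtain w where "w \<noteq> 0" "orthogonal q w"
      using orthogonal_to_vector_exists[of q] dim by auto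
    moreover have "sin \<theta> = 0"
    proof -
      have "1 = \<bar>cos \<theta>\<bar>" using p q True by (metis norm_scaleR mult.right_neutral)
      then have "(cos \<theta>)\<^sup>2 = 1" by (metis power2_abs one_power2)
      then show ?thesis using sin_cos_squared_add[of \<theta>] by simp
    qed
    ultimately show ?thesis
      using that[of "w /\<^sub>R norm w"] True by (auto simp: orthogonal_def inner_commute)
  next
    case False
    define r where "r = p - cos \<theta> *\<^sub>R q"
    have r: "r \<bullet> q = 0" using q \<theta> by (simp add: r_def inner_diff_left dot_square_norm)
    have "(norm r)\<^sup>2 = (sin \<theta>)\<^sup>2"
    proof -
      have "(norm r)\<^sup>2 = (norm p)\<^sup>2 - 2 * cos \<theta> * (p \<bullet> q) + (cos \<theta>)\<^sup>2 * (norm q)\<^sup>2"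
        unfolding r_def power2_norm_eq_inner power2_eq_square[of "cos \<theta>"]
        by (simp add: inner_diff_left inner_diff_right inner_commute[of q p] algebra_simps)
      then show ?thesis
        using p q \<theta>(1) sin_cos_squared_add[of \<theta>] by (simp add: power2_eq_square)
    qed
    then have "norm r = sin \<theta>" using \<theta> by (simp add: sin_ge_zero)
    moreover have "norm r \<noteq> 0" using False by (simp add: r_def)
    ultimately have "norm (r /\<^sub>R norm r) = 1" "(r /\<^sub>R norm r) \<bullet> q = 0" "sin \<theta> *\<^sub>R (r /\<^sub>R norm r) = r"
      using r sin_ge_zero[OF \<theta>(2,3)] by auto
    moreover have "p = cos \<theta> *\<^sub>R q + r" by (simp add: r_def)
    ultimately show ?thesis using that[of "r /\<^sub>R norm r"] by simp
  qed
  \<comment> \<open>The angle runs down from \<open>\<theta>\<close> to 0 so that the arc starts at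
    \<open>p\<close>; the speed is constantly \<open>\<theta>\<close>.\<close>
  define \<gamma> where "\<gamma> = (\<lambda>t. cos ((1 - t) * \<theta>) *\<^sub>R q + sin ((1 - t) * \<theta>) *\<^sub>R w)"
  define \<gamma>' where "\<gamma>' = (\<lambda>t. (\<theta> * sin ((1 - t) * \<theta>)) *\<^sub>R q + (- \<theta> * cos ((1 - t) * \<theta>)) *\<^sub>R w)"
  have norm_comb: "norm (a *\<^sub>R q + b *\<^sub>R w) = sqrt (a\<^sup>2 + b\<^sup>2)" for a b
  proof (rule real_sqrt_unique[symmetric])
    have "w \<bullet> w = 1" "q \<bullet> q = 1" "q \<bullet> w = 0"
      using q w by (simp_all add: dot_square_norm inner_commute)
    then show "(norm (a *\<^sub>R q + b *\<^sub>R w))\<^sup>2 = a\<^sup>2 + b\<^sup>2"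
      unfolding power2_norm_eq_inner
      by (simp add: inner_add_left inner_add_right inner_commute[of w q] power2_eq_square)
  qed simp
  have der: "(\<gamma> has_vector_derivative \<gamma>' t) (at t)" for t
    unfolding \<gamma>_def \<gamma>'_def
    by (auto intro!: derivative_eq_intros simp: has_real_derivative_iff_has_vector_derivative[symmetric] algebra_simps)
  have "\<gamma> C1_differentiable_on {0..1}"
    unfolding C1_differentiable_on_def
  proof (intro exI[of _ \<gamma>'] conjI ballI der)
    show "continuous_on {0..1} \<gamma>'"
      unfolding \<gamma>'_def by (intro continuous_intros)
  qed
  then have "valid_path \<gamma>"
    unfolding valid_path_def by (rule C1_differentiable_imp_piecewise)
  moreover have "path_image \<gamma> \<subseteq> sphere 0 1"
    by (auto simp: path_image_def \<gamma>_def norm_comb)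
  moreover have "pathstart \<gamma> = p" "pathfinish \<gamma> = q"
    by (auto simp: pathstart_def pathfinish_def \<gamma>_def w(3)[symmetric])
  moreover have "((\<lambda>t. norm (vector_derivative \<gamma> (at t))) has_integral \<theta>) {0..1}"
  proof -
    have "norm (vector_derivative \<gamma> (at t)) = \<theta>" for t
    proof -
      have "norm (\<gamma>' t) = sqrt ((\<theta> * sin ((1 - t) * \<theta>))\<^sup>2 + (- \<theta> * cos ((1 - t) * \<theta>))\<^sup>2)"
        unfolding \<gamma>'_def by (rule norm_comb)
      also have "(\<theta> * sin ((1 - t) * \<theta>))\<^sup>2 + (- \<theta> * cos ((1 - t) * \<theta>))\<^sup>2 = \<theta>\<^sup>2"
        by (simp add: power_mult_distrib distrib_left[symmetric])
      finally show ?thesis using \<theta> by (simp add: vector_derivative_at[OF der])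
    qed
    then show ?thesis using has_integral_const_real[of \<theta> 0 1] by simp
  qed
  ultimately show ?thesis
    unfolding geodesic_dist_def \<theta>_def[symmetric]
    by (intro cInf_eq_minimum) (auto simp: \<theta>_def intro: length_ge_arccos)
qed

subsection \<open>Polar coordinates\<close>

definition stereo_factor :: "'a::real_normed_vector \<Rightarrow> real"
  where "stereo_factor z = 2 / (1 + (norm z)\<^sup>2)"

text \<open>The ball of radius \<open>a\<close> in dimension \<open>d\<close> has volume
  \<open>unit_ball_vol d * a ^ d\<close>, whose derivative in \<open>a\<close> is the density;
  half-lines \<open>{..a}\<close> suffice as a generator stable under intersection.\<close>

lemma distr_norm_lborel:
  "distr lborel borel (norm :: 'a::euclidean_space \<Rightarrow> real) =
    density lborel (\<lambda>r. ennreal (real DIM('a) * unit_ball_vol DIM('a) * r ^ (DIM('a) - 1)) * indicator {0..} r)"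
    (is "?L = density lborel (\<lambda>r. ennreal (?w r) * _)")
proof (rule measure_eqI_generator_eq[where E = "range atMost" and \<Omega> = UNIV and A = "\<lambda>k. {..real k}"])
  have ball: "emeasure ?L {..a} = ennreal (unit_ball_vol DIM('a) * a ^ DIM('a)) * indicator {0..} a" for a
  proof -
    have "emeasure ?L {..a} = emeasure lborel (cball (0 :: 'a) a)"
      by (subst emeasure_distr) (auto intro!: arg_cong[of _ _ "emeasure _"])
    then show ?thesis by (cases "a \<ge> 0") (auto simp: emeasure_cball)
  qed
  fix X assume "X \<in> range (atMost :: real \<Rightarrow> _)"
  then obtain a where a: "X = {..a}" by auto
  show "emeasure ?L X = emeasure (density lborel (\<lambda>r. ennreal (?w r) * indicator {0..} r)) X"
  proof (cases "a \<ge> 0")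
    case True
    have "(\<integral>\<^sup>+r. ennreal (?w r) * indicator {0..} r * indicator X r \<partial>lborel) = (\<integral>\<^sup>+r. ennreal (?w r) * indicator {0..a} r \<partial>lborel)"
      by (intro nn_integral_cong) (auto simp: a split: split_indicator)
    also have "\<dots> = ennreal (unit_ball_vol DIM('a) * a ^ DIM('a) - unit_ball_vol DIM('a) * 0 ^ DIM('a))"
      by (rule nn_integral_FTC_Icc) (use True in \<open>auto intro!: derivative_eq_intros\<close>)
    finally show ?thesis
      using True ball[of a] by (simp add: a emeasure_density)
  next
    case False
    have "(\<integral>\<^sup>+r. ennreal (?w r) * indicator {0..} r * indicator X r \<partial>lborel) = (\<integral>\<^sup>+(r::real). 0 \<partial>lborel)"
      by (intro nn_integral_cong) (use False in \<open>auto simp: a split: split_indicator\<close>)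
    then show ?thesis
      using False ball[of a] by (simp add: a emeasure_density)
  qed
next
  show "Int_stable (range (atMost :: real \<Rightarrow> _))"
    by (auto simp: Int_stable_def min_def intro!: range_eqI[of _ _ "min _ _"])
  show "sets ?L = sigma_sets UNIV (range (atMost :: real \<Rightarrow> _))"
    by (simp add: borel_eq_atMost)
  show "sets (density lborel (\<lambda>r. ennreal (?w r) * indicator {0..} r)) = sigma_sets UNIV (range (atMost :: real \<Rightarrow> _))"
    by (simp add: borel_eq_atMost)
  show "(\<Union>k. {..real k}) = UNIV" by (auto intro: real_arch_simple)
  show "emeasure ?L {..real k} \<noteq> \<infinity>" for k
  proof -
    have "emeasure ?L {..real k} = emeasure lborel (cball (0 :: 'a) (real k))"
      by (subst emeasure_distr) (auto intro!: arg_cong[of _ _ "emeasure _"])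
    then show ?thesis by (simp add: emeasure_cball)
  qed
qed auto

lemma nn_integral_norm:
  fixes k :: "real \<Rightarrow> ennreal"
  assumes [measurable]: "k \<in> borel_measurable borel"
  shows "(\<integral>\<^sup>+z. k (norm (z :: 'a::euclidean_space)) \<partial>lborel) =
    ennreal (real DIM('a) * unit_ball_vol DIM('a)) * (\<integral>\<^sup>+r. k r * ennreal (r ^ (DIM('a) - 1)) * indicator {0..} r \<partial>lborel)"
proof -
  have "(\<integral>\<^sup>+z. k (norm (z :: 'a)) \<partial>lborel) = (\<integral>\<^sup>+r. k r \<partial>distr lborel borel (norm :: 'a \<Rightarrow> real))"
    by (rule nn_integral_distr[symmetric]) auto
  also have "\<dots> = (\<integral>\<^sup>+r. ennreal (real DIM('a) * unit_ball_vol DIM('a) * r ^ (DIM('a) - 1)) * indicator {0..} r * k r \<partial>lborel)"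
    unfolding distr_norm_lborel by (intro nn_integral_density) auto
  also have "\<dots> = (\<integral>\<^sup>+r. ennreal (real DIM('a) * unit_ball_vol DIM('a)) * (k r * ennreal (r ^ (DIM('a) - 1)) * indicator {0..} r) \<partial>lborel)"
    by (intro nn_integral_cong) (auto simp: ennreal_mult mult_ac split: split_indicator)
  also have "\<dots> = ennreal (real DIM('a) * unit_ball_vol DIM('a)) * (\<integral>\<^sup>+r. k r * ennreal (r ^ (DIM('a) - 1)) * indicator {0..} r \<partial>lborel)"
    by (intro nn_integral_cmult) auto
  finally show ?thesis .
qed

text \<open>The substitution is made on compact intervals and passes to their union by continuity
  from below. The value \<open>pi\<close> is never attained by \<open>2 * arctan\<close>, hence the
  half-open range; \<open>Suc k\<close> keeps each interval nondegenerate.\<close>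

lemma nn_integral_two_arctan:
  fixes h :: "real \<Rightarrow> ennreal"
  assumes [measurable]: "h \<in> borel_measurable borel"
  shows "(\<integral>\<^sup>+x. h (2 * arctan x) * ennreal (2 / (1 + x\<^sup>2)) * indicator {0..} x \<partial>lborel) =
    (\<integral>\<^sup>+x. h x * indicator {0..<pi} x \<partial>lborel)"
proof -
  let ?g = "\<lambda>x. 2 * arctan x"
  let ?M = "density lborel (\<lambda>x. h (?g x) * ennreal (2 / (1 + x\<^sup>2)))"
  have eq: "emeasure (density lborel h) {0..?g (real (Suc k))} = emeasure ?M {0..real (Suc k)}" for k
  proof -
    have "(\<integral>\<^sup>+x. h x * indicator {?g 0..?g (real (Suc k))} x \<partial>lborel) =
        (\<integral>\<^sup>+x. h (?g x) * ennreal (2 / (1 + x\<^sup>2)) * indicator {0..real (Suc k)} x \<partial>lborel)"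
    proof (rule nn_integral_substitution_aux)
      show "(?g has_real_derivative 2 / (1 + x\<^sup>2)) (at x)" for x
        by (auto intro!: derivative_eq_intros simp: field_simps add_nonneg_eq_0_iff)
      show "continuous_on {0..real (Suc k)} (\<lambda>x. 2 / (1 + x\<^sup>2))"
        by (intro continuous_intros) (auto simp: add_nonneg_eq_0_iff)
    qed auto
    then show ?thesis by (simp add: emeasure_density)
  qed
  have U: "(\<Union>k. {0..?g (real (Suc k))}) = {0..<pi}"
  proof (intro equalityI subsetI)
    fix x assume "x \<in> (\<Union>k. {0..?g (real (Suc k))})"
    then obtain k where "0 \<le> x" "x \<le> ?g (real (Suc k))" by auto
    moreover have "?g (real (Suc k)) < pi" using arctan_ubound[of "real (Suc k)"] by simp
    ultimately show "x \<in> {0..<pi}" by (auto simp del: of_nat_Suc)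
  next
    fix x assume x: "x \<in> {0..<pi}"
    obtain k where "tan (x / 2) \<le> real k" using real_arch_simple by blast
    then have "arctan (tan (x / 2)) \<le> arctan (real (Suc k))" by (simp add: arctan_le_iff)
    moreover have "arctan (tan (x / 2)) = x / 2" using x by (intro arctan_tan) auto
    ultimately have "x \<in> {0..?g (real (Suc k))}" using x by simp
    then show "x \<in> (\<Union>k. {0..?g (real (Suc k))})" by (rule UN_I[OF UNIV_I])
  qed
  have U': "(\<Union>k. {0..real (Suc k)}) = {0..}"
  proof (intro equalityI subsetI)
    fix x :: real assume x: "x \<in> {0..}"
    obtain k where "x \<le> real k" using real_arch_simple by blast
    then have "x \<in> {0..real (Suc k)}" using x by simp
    then show "x \<in> (\<Union>k. {0..real (Suc k)})" by (rule UN_I[OF UNIV_I])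
  qed auto
  have "emeasure (density lborel h) {0..<pi} = (SUP k. emeasure (density lborel h) {0..?g (real (Suc k))})"
    unfolding U[symmetric] by (rule SUP_emeasure_incseq[symmetric]) (auto simp: incseq_def arctan_le_iff)
  also have "\<dots> = (SUP k. emeasure ?M {0..real (Suc k)})"
    unfolding eq ..
  also have "\<dots> = emeasure ?M {0..}"
    unfolding U'[symmetric] by (rule SUP_emeasure_incseq) (auto simp: incseq_def)
  finally show ?thesis by (simp add: emeasure_density)
qed

text \<open>Double-angle formulas for \<open>2 * arctan r\<close>. For a point whose stereographic
  coordinate has norm \<open>r\<close>, the first expression is its distance from the axis through
  the poles and the second its height along that axis.\<close>

lemma stereo_factor_two_arctan:
  "2 / (1 + r\<^sup>2) * r = sin (2 * arctan r)" "2 / (1 + r\<^sup>2) - 1 = cos (2 * arctan r)"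
proof -
  have "0 < 1 + r\<^sup>2" by (simp add: add_pos_nonneg)
  then have "(sqrt (1 + r\<^sup>2))\<^sup>2 = 1 + r\<^sup>2" "1 + r\<^sup>2 \<noteq> 0" "sqrt (1 + r\<^sup>2) \<noteq> 0" by auto
  then show "2 / (1 + r\<^sup>2) * r = sin (2 * arctan r)" "2 / (1 + r\<^sup>2) - 1 = cos (2 * arctan r)"
    unfolding sin_double cos_double_cos sin_arctan cos_arctan
    by (simp_all add: power_divide power2_eq_square)
qed

lemma nn_integral_stereo_factor:
  fixes f :: "real \<Rightarrow> ennreal"
  assumes [measurable]: "f \<in> borel_measurable borel"
  shows "(\<integral>\<^sup>+z. f (2 * arctan (norm z)) * ennreal (stereo_factor (z :: 'a::euclidean_space) ^ DIM('a)) \<partial>lborel) =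
    ennreal (real DIM('a) * unit_ball_vol DIM('a)) *
      (\<integral>\<^sup>+\<theta>. f \<theta> * ennreal (sin \<theta> ^ (DIM('a) - 1)) * indicator {0..<pi} \<theta> \<partial>lborel)"
proof -
  let ?n = "DIM('a)" and ?w = "\<lambda>r::real. 2 / (1 + r\<^sup>2)"
  have n: "?n = Suc (?n - 1)" using DIM_positive[where 'a='a] by simp
  have "(\<integral>\<^sup>+z. f (2 * arctan (norm z)) * ennreal (stereo_factor (z :: 'a) ^ ?n) \<partial>lborel) =
      (\<integral>\<^sup>+z. f (2 * arctan (norm (z :: 'a))) * ennreal (?w (norm z) ^ ?n) \<partial>lborel)"
    by (simp add: stereo_factor_def)
  also have "\<dots> = ennreal (real ?n * unit_ball_vol ?n) *
      (\<integral>\<^sup>+r. f (2 * arctan r) * ennreal (?w r ^ ?n) * ennreal (r ^ (?n - 1)) * indicator {0..} r \<partial>lborel)"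
    by (rule nn_integral_norm[of "\<lambda>r. f (2 * arctan r) * ennreal (?w r ^ ?n)"]) measurable
  also have "(\<integral>\<^sup>+r. f (2 * arctan r) * ennreal (?w r ^ ?n) * ennreal (r ^ (?n - 1)) * indicator {0..} r \<partial>lborel) =
      (\<integral>\<^sup>+r. (f (2 * arctan r) * ennreal (sin (2 * arctan r) ^ (?n - 1))) * ennreal (?w r) * indicator {0..} r \<partial>lborel)"
  proof (intro nn_integral_cong)
    fix r :: real
    have w: "?w r \<ge> 0" by simp
    \<comment> \<open>One factor \<open>?w r\<close> is kept as the derivative of
      \<open>2 * arctan r\<close>; each of the others is paired with a factor \<open>r\<close> to
      form a sine.\<close>
    have "?w r ^ ?n * r ^ (?n - 1) = (?w r * r) ^ (?n - 1) * ?w r"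
      by (subst n) (simp only: power_Suc power_mult_distrib mult_ac)
    then have "ennreal (?w r ^ ?n) * ennreal (r ^ (?n - 1)) = ennreal (sin (2 * arctan r) ^ (?n - 1)) * ennreal (?w r)" if "r \<ge> 0"
      using w that unfolding stereo_factor_two_arctan(1)[symmetric]
      by (subst (1 2) ennreal_mult[symmetric]) auto
    then show "f (2 * arctan r) * ennreal (?w r ^ ?n) * ennreal (r ^ (?n - 1)) * indicator {0..} r =
      f (2 * arctan r) * ennreal (sin (2 * arctan r) ^ (?n - 1)) * ennreal (?w r) * indicator {0..} r"
      by (simp add: mult.assoc split: split_indicator)
  qed
  also have "\<dots> = (\<integral>\<^sup>+\<theta>. f \<theta> * ennreal (sin \<theta> ^ (?n - 1)) * indicator {0..<pi} \<theta> \<partial>lborel)"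
    by (rule nn_integral_two_arctan) measurable
  finally show ?thesis .
qed

text \<open>Both sides are the area of the unit sphere in \<open>n\<close>-dimensional space. The
  recursion \<open>Gamma (x + 1) = x * Gamma x\<close> at \<open>x = n / 2\<close> absorbs the
  factor \<open>n\<close>.\<close>

lemma sphere_area_constant:
  assumes "n > 0"
  shows "real n * unit_ball_vol n = 2 * pi powr (real n / 2) / Gamma (real n / 2)"
proof -
  have Gamma: "Gamma (real n / 2 + 1) = real n / 2 * Gamma (real n / 2)"
    using assms by (subst Gamma_plus1) (auto dest: nonpos_Ints_nonpos)
  show ?thesis unfolding unit_ball_vol_def Gamma using assms by simp
qed

subsection \<open>Riemannian volume of the sphere\<close>

text \<open>\<open>E\<close> identifies \<open>real ^ 'n\<close> isometrically with the hyperplane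
  orthogonal to the pole. No choice of it is canonical, hence the locale parameter; the locale is
  also instantiated at the opposite pole, to reach the point that one chart misses.\<close>

locale stereographic =
  fixes \<mu> :: "real ^ ('n::finite + 1)" and E :: "real ^ 'n \<Rightarrow> real ^ ('n + 1)"
  assumes norm_pole: "norm \<mu> = 1" and linear_E: "linear E"
    and norm_E: "\<And>x. norm (E x) = norm x" and range_E: "range E = {y. y \<bullet> \<mu> = 0}"
begin

text \<open>The line from \<open>- \<mu>\<close> through \<open>E z\<close> consists of the points
  \<open>- \<mu> + t *\<^sub>R (E z + \<mu>)\<close> and meets the sphere again at
  \<open>t = stereo_factor z\<close>. The origin goes to \<open>\<mu>\<close>.\<close>

definition param :: "real ^ 'n \<Rightarrow> real ^ ('n + 1)"
  where "param z = stereo_factor z *\<^sub>R (E z + \<mu>) - \<mu>"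

text \<open>Inverse of \<open>param\<close>: \<open>adjoint E\<close> is orthogonal projection to
  the hyperplane, read in coordinates. At \<open>- \<mu>\<close> the division by zero yields the
  value 0.\<close>

definition coord :: "real ^ ('n + 1) \<Rightarrow> real ^ 'n"
  where "coord y = (1 / (1 + y \<bullet> \<mu>)) *\<^sub>R adjoint E y"

text \<open>The derivative of \<open>param\<close> at \<open>z\<close> by the product rule, where
  the conformal factor has derivative \<open>- (stereo_factor z)\<^sup>2 * (z \<bullet> h)\<close>
  in direction \<open>h\<close>.\<close>

definition dparam :: "real ^ 'n \<Rightarrow> real ^ 'n \<Rightarrow> real ^ ('n + 1)"
  where "dparam z h = stereo_factor z *\<^sub>R E h - ((stereo_factor z)\<^sup>2 * (z \<bullet> h)) *\<^sub>R (E z + \<mu>)"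

definition sphere_vol :: "(real ^ ('n + 1)) measure"
  where "sphere_vol = distr (density lborel (\<lambda>z. ennreal (stereo_factor z ^ CARD('n)))) (restrict_space borel (sphere 0 1)) param"

text \<open>Both poles have the same orthogonal hyperplane, so one \<open>E\<close> serves the
  antipodal chart as well.\<close>

lemma stereographic_uminus: "stereographic (- \<mu>) E"
  unfolding stereographic_def using norm_pole linear_E norm_E range_E by auto

lemma pole_inner: "\<mu> \<bullet> \<mu> = 1"
  using norm_pole by (simp add: dot_square_norm)

lemma inner_E: "E x \<bullet> E y = x \<bullet> y"
  by (simp add: dot_norm linear_add[OF linear_E, symmetric] norm_E)

lemma E_inner_pole: "E x \<bullet> \<mu> = 0"
  using range_E by auto

lemma adjoint_E: "adjoint E (E x) = x"
  by (rule vector_eq_ldot[THEN iffD1], rule allI) (simp add: adjoint_works[OF linear_E] inner_E)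

lemma adjoint_pole: "adjoint E \<mu> = 0"
  by (rule vector_eq_ldot[THEN iffD1], rule allI) (simp add: adjoint_works[OF linear_E] E_inner_pole)

lemma linear_adjoint: "linear (adjoint E)"
  by (rule adjoint_linear[OF linear_E])

lemma E_adjoint: "E (adjoint E y) = y - (y \<bullet> \<mu>) *\<^sub>R \<mu>"
proof -
  have "(y - (y \<bullet> \<mu>) *\<^sub>R \<mu>) \<bullet> \<mu> = 0"
    by (simp add: inner_diff_left pole_inner)
  then obtain x where x: "y - (y \<bullet> \<mu>) *\<^sub>R \<mu> = E x"
    using range_E by blast
  then have "y = E x + (y \<bullet> \<mu>) *\<^sub>R \<mu>" by (simp add: algebra_simps)
  then have "adjoint E y = adjoint E (E x) + (y \<bullet> \<mu>) *\<^sub>R adjoint E \<mu>"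
    by (metis linear_add[OF linear_adjoint] linear_scale[OF linear_adjoint])
  then show ?thesis by (simp add: adjoint_E adjoint_pole x)
qed

lemma one_plus_sq: "0 < 1 + (norm (z :: real ^ 'n))\<^sup>2"
  by (simp add: add_pos_nonneg)

lemma stereo_factor_pos: "0 < stereo_factor (z :: real ^ 'n)"
  using one_plus_sq by (simp add: stereo_factor_def)

lemma stereo_factor_mult: "stereo_factor (z :: real ^ 'n) * (1 + (norm z)\<^sup>2) = 2"
  unfolding stereo_factor_def
  by (rule nonzero_eq_divide_eq[THEN iffD1, OF _ refl]) (use one_plus_sq[of z] in simp)

lemma norm_E_add_pole: "(E z + \<mu>) \<bullet> (E z + \<mu>) = 1 + (norm z)\<^sup>2"
  by (simp add: inner_add_left inner_add_right pole_inner E_inner_pole inner_commute[of \<mu> "E z"] inner_E power2_norm_eq_inner)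

lemma param_inner_pole: "param z \<bullet> \<mu> = stereo_factor z - 1"
  by (simp add: param_def inner_diff_left inner_add_left E_inner_pole pole_inner)

lemma norm_param: "norm (param z) = 1"
proof -
  have "(norm (param z))\<^sup>2 = (stereo_factor z)\<^sup>2 * ((E z + \<mu>) \<bullet> (E z + \<mu>)) - 2 * stereo_factor z * ((E z + \<mu>) \<bullet> \<mu>) + \<mu> \<bullet> \<mu>"
    unfolding param_def power2_norm_eq_inner
    by (simp only: inner_diff_left inner_diff_right inner_scaleR_left inner_scaleR_right
        inner_commute[of \<mu> "E z + \<mu>"] power2_eq_square) (simp add: algebra_simps)
  also have "(E z + \<mu>) \<bullet> \<mu> = 1"
    by (simp add: inner_add_left E_inner_pole pole_inner)
  also have "(stereo_factor z)\<^sup>2 * ((E z + \<mu>) \<bullet> (E z + \<mu>)) = stereo_factor z * (stereo_factor z * (1 + (norm z)\<^sup>2))"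
    by (simp add: norm_E_add_pole power2_eq_square)
  finally have "(norm (param z))\<^sup>2 = 1"
    by (simp only: stereo_factor_mult pole_inner)
  then show ?thesis by (simp add: power2_eq_1_iff) (use norm_ge_zero[of "param z"] in linarith)
qed

lemma param_ne: "param z \<noteq> - \<mu>"
  using param_inner_pole[of z] stereo_factor_pos[of z] pole_inner by auto

lemma coord_param: "coord (param z) = z"
proof -
  have "adjoint E (param z) = stereo_factor z *\<^sub>R z"
    by (simp add: param_def linear_diff[OF linear_adjoint] linear_scale[OF linear_adjoint]
        linear_add[OF linear_adjoint] adjoint_E adjoint_pole)
  then show ?thesis
    using stereo_factor_pos[of z] by (simp add: coord_def param_inner_pole)
qed

text \<open>The quantity is half the squared distance from \<open>y\<close> to
  \<open>- \<mu>\<close>.\<close>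

lemma inner_pole_gt:
  assumes "norm y = 1" "y \<noteq> - \<mu>"
  shows "0 < 1 + y \<bullet> \<mu>"
proof -
  have "0 < (norm (y + \<mu>))\<^sup>2"
    using assms(2) by (simp add: add_eq_0_iff2)
  also have "(norm (y + \<mu>))\<^sup>2 = 2 * (1 + y \<bullet> \<mu>)"
  proof -
    have "y \<bullet> y = 1" using assms(1) by (simp add: dot_square_norm)
    then show ?thesis
      unfolding power2_norm_eq_inner
      by (simp add: inner_add_left inner_add_right pole_inner inner_commute[of \<mu> y])
  qed
  finally show ?thesis by simp
qed

text \<open>The key identity is \<open>stereo_factor (coord y) = 1 + y \<bullet> \<mu>\<close>. It
  follows from \<open>1 - c\<^sup>2 = (1 - c) * (1 + c)\<close> for the height
  \<open>c\<close>.\<close>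

lemma param_coord:
  assumes "norm y = 1" "y \<noteq> - \<mu>"
  shows "param (coord y) = y"
proof -
  define c where "c = y \<bullet> \<mu>"
  have c: "0 < 1 + c" using inner_pole_gt[OF assms] by (simp add: c_def)
  have E: "E (coord y) = (1 / (1 + c)) *\<^sub>R (y - c *\<^sub>R \<mu>)"
    by (simp add: coord_def c_def linear_scale[OF linear_E] E_adjoint)
  have "(norm (y - c *\<^sub>R \<mu>))\<^sup>2 = 1 - c\<^sup>2"
  proof -
    have "y \<bullet> y = 1" using assms(1) by (simp add: dot_square_norm)
    then show ?thesis
      unfolding power2_norm_eq_inner
      by (simp add: inner_diff_left inner_diff_right c_def inner_commute[of \<mu> y] pole_inner power2_eq_square)
  qed
  then have "(norm (coord y))\<^sup>2 = (1 - c\<^sup>2) / (1 + c)\<^sup>2"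
    using c by (simp add: norm_E[symmetric, of "coord y"] E power_mult_distrib power_divide)
  also have "\<dots> = (1 - c) / (1 + c)"
  proof -
    have "1 - c\<^sup>2 = (1 - c) * (1 + c)" by (simp add: power2_eq_square algebra_simps)
    then show ?thesis using c by (simp add: power2_eq_square[of "1 + c"])
  qed
  finally have "1 + (norm (coord y))\<^sup>2 = 2 / (1 + c)"
    using c by (simp add: field_simps)
  then have "stereo_factor (coord y) = 1 + c"
    by (simp add: stereo_factor_def)
  then have "param (coord y) = (y - c *\<^sub>R \<mu>) + (1 + c) *\<^sub>R \<mu> - \<mu>"
    using c by (simp add: param_def E scaleR_right_distrib)
  then show ?thesis by (simp add: algebra_simps)
qed

lemma range_param: "range param = sphere 0 1 - {- \<mu>}"
proof (intro equalityI subsetI)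
  fix y assume "y \<in> sphere 0 1 - {- \<mu>}"
  then show "y \<in> range param" using param_coord[of y] by (auto intro!: range_eqI[of _ _ "coord y"])
qed (auto simp: norm_param param_ne)

section \<open>Differential and conformality of the stereographic chart\<close>

lemma param_has_derivative: "(param has_derivative dparam z) (at z)"
proof -
  have E: "(E has_derivative E) (at z)" by (rule linear_imp_has_derivative[OF linear_E])
  have sf: "stereo_factor = (\<lambda>z :: real ^ 'n. 2 / (1 + z \<bullet> z))"
    by (simp add: stereo_factor_def fun_eq_iff power2_norm_eq_inner)
  have nz: "1 + z \<bullet> z \<noteq> 0" using one_plus_sq[of z] by (simp add: power2_norm_eq_inner)
  have "((\<lambda>z :: real ^ 'n. 2 / (1 + z \<bullet> z)) has_derivative (\<lambda>h. - ((2 / (1 + z \<bullet> z))\<^sup>2 * (z \<bullet> h)))) (at z)"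
    using nz by (auto intro!: derivative_eq_intros simp: fun_eq_iff inner_commute power2_eq_square divide_inverse)
  then have "((\<lambda>z. stereo_factor z *\<^sub>R (E z + \<mu>) - \<mu>) has_derivative
      (\<lambda>h. stereo_factor z *\<^sub>R (E h + 0) + (- ((stereo_factor z)\<^sup>2 * (z \<bullet> h))) *\<^sub>R (E z + \<mu>) - 0)) (at z)"
    unfolding sf[symmetric] sf[THEN fun_cong, symmetric]
    by (intro has_derivative_diff has_derivative_scaleR has_derivative_add E has_derivative_const)
  then show ?thesis
    by (simp add: param_def[abs_def] dparam_def[abs_def])
qed

text \<open>Conformality: the terms in \<open>(z \<bullet> h) * (z \<bullet> k)\<close> cancel
  because \<open>E z + \<mu>\<close> has squared length \<open>2 / stereo_factor z\<close>.\<close>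

lemma inner_dparam: "dparam z h \<bullet> dparam z k = (stereo_factor z)\<^sup>2 * (h \<bullet> k)"
proof -
  let ?l = "stereo_factor z" and ?w = "E z + \<mu>"
  have w1: "E h \<bullet> ?w = z \<bullet> h" for h
    by (simp add: inner_add_right E_inner_pole inner_E inner_commute[of h z])
  have w2: "?w \<bullet> E h = z \<bullet> h" for h
    by (simp only: inner_commute[of ?w "E h"] w1)
  have "dparam z h \<bullet> dparam z k = ?l\<^sup>2 * (h \<bullet> k) - 2 * ?l ^ 3 * (z \<bullet> h) * (z \<bullet> k) + ?l ^ 4 * (z \<bullet> h) * (z \<bullet> k) * (?w \<bullet> ?w)"
    unfolding dparam_def
    by (simp only: inner_diff_left inner_diff_right inner_scaleR_left inner_scaleR_right w1 w2 inner_E) algebra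
  also have "?l ^ 4 * (z \<bullet> h) * (z \<bullet> k) * (?w \<bullet> ?w) = ?l ^ 3 * (z \<bullet> h) * (z \<bullet> k) * (?l * (1 + (norm z)\<^sup>2))"
    unfolding norm_E_add_pole by algebra
  finally show ?thesis by (simp only: stereo_factor_mult)
qed

lemma linear_dparam: "linear (dparam z)"
  using param_has_derivative by (rule has_derivative_linear)

lemma blinfun_apply_dparam: "blinfun_apply (Blinfun (dparam z)) = dparam z"
  using linear_dparam by (simp add: bounded_linear_Blinfun_apply linear_conv_bounded_linear)

end

section \<open>Area density in stereographic coordinates\<close>

lemma det_scaled_gram:
  fixes M :: "real ^ 'n::finite ^ 'n"
  shows "det (c *\<^sub>R (transpose M ** M)) = c ^ CARD('n) * (det M)\<^sup>2"
proof -
  let ?P = "(\<chi> i j. if i = j then c else 0) :: real ^ 'n ^ 'n"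
  have "c *\<^sub>R (transpose M ** M) = ?P ** (transpose M ** M)"
    by (simp add: vec_eq_iff matrix_matrix_mult_def[of ?P] if_distrib[of "\<lambda>x. x * _"] cong: if_cong)
  then show ?thesis
    by (simp add: det_mul det_diagonal power2_eq_square)
qed

context stereographic
begin

text \<open>By conformality the metric is \<open>(stereo_factor z)\<^sup>2\<close> times the Gram
  matrix of \<open>T\<close>, so its determinant is a perfect square. \<open>T\<close> will be the
  derivative of a transition map, or the identity for the chart \<open>param\<close> itself.\<close>

lemma metric_matrix_comp:
  assumes D: "\<And>h. blinfun_apply D h = dparam z (T h)"
  shows "sqrt (det (metric_matrix D)) = stereo_factor z ^ CARD('n) * \<bar>det (matrix T)\<bar>"
proof -
  have "(transpose (matrix T) ** matrix T) $ i $ j = T (axis i 1) \<bullet> T (axis j 1)" for i j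
    by (simp add: matrix_matrix_mult_def transpose_def matrix_def inner_vec_def)
  then have "metric_matrix D = (stereo_factor z)\<^sup>2 *\<^sub>R (transpose (matrix T) ** matrix T)"
    by (simp add: metric_matrix_def D inner_dparam vec_eq_iff)
  then have "det (metric_matrix D) = (stereo_factor z ^ CARD('n) * \<bar>det (matrix T)\<bar>)\<^sup>2"
    by (simp add: det_scaled_gram power_mult_distrib power_mult[symmetric] mult.commute)
  then show ?thesis
    using stereo_factor_pos[of z] by simp
qed

lemma metric_matrix_dparam: "sqrt (det (metric_matrix (Blinfun (dparam z)))) = stereo_factor z ^ CARD('n)"
  using metric_matrix_comp[of "Blinfun (dparam z)" z id] by (simp add: blinfun_apply_dparam matrix_id)

lemma continuous_on_param: "continuous_on A param"
  using param_has_derivative by (meson continuous_at_imp_continuous_on has_derivative_continuous)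

lemma continuous_on_coord: "continuous_on (sphere 0 1 - {- \<mu>}) coord"
proof -
  have "1 + y \<bullet> \<mu> \<noteq> 0" if "y \<in> sphere 0 1 - {- \<mu>}" for y
    using inner_pole_gt[of y] that by auto
  then show ?thesis
    unfolding coord_def
    by (intro continuous_intros linear_continuous_on linear_conv_bounded_linear[THEN iffD1] linear_adjoint) auto
qed

lemma continuous_on_stereo_factor: "continuous_on A (stereo_factor :: real ^ 'n \<Rightarrow> real)"
  unfolding stereo_factor_def using one_plus_sq by (intro continuous_intros) (metis less_irrefl)

lemma local_param_stereographic:
  "local_param (sphere 0 1) UNIV param (\<lambda>z. Blinfun (dparam z))"
  unfolding local_param_def
proof (intro conjI ballI)
  show "openin (top_of_set (sphere 0 1)) (range param)"
    unfolding range_param by (rule openin_delete[OF openin_subtopology_self])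
  have "homeomorphism UNIV (range param) param coord"
    using continuous_on_param continuous_on_coord
    by (intro homeomorphismI) (auto simp: range_param coord_param param_coord)
  then show "\<exists>\<psi>. homeomorphism UNIV (range param) param \<psi>" by blast
  show "continuous_on UNIV (\<lambda>z. Blinfun (dparam z))"
  proof (rule continuous_on_blinfun_componentwise)
    show "continuous_on UNIV (\<lambda>z. blinfun_apply (Blinfun (dparam z)) h)" for h
      unfolding blinfun_apply_dparam dparam_def
      by (intro continuous_intros continuous_on_stereo_factor linear_continuous_on
          linear_conv_bounded_linear[THEN iffD1] linear_E)
  qed
  show "inj (blinfun_apply (Blinfun (dparam z)))" for z
    unfolding blinfun_apply_dparam linear_injective_0[OF linear_dparam]
  proof (intro allI impI)
    \<comment> \<open>Injectivity comes from conformality: a vector in the kernel has length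
      zero.\<close>
    fix h assume "dparam z h = 0"
    then have "(stereo_factor z)\<^sup>2 * (h \<bullet> h) = 0" using inner_dparam[of z h h] by simp
    then show "h = 0" using stereo_factor_pos[of z] by simp
  qed
qed (auto simp: blinfun_apply_dparam param_has_derivative)

lemma measurable_param [measurable]: "param \<in> borel_measurable borel"
  by (intro borel_measurable_continuous_onI continuous_on_param)

lemma measurable_stereo_factor [measurable]: "(stereo_factor :: real ^ 'n \<Rightarrow> real) \<in> borel_measurable borel"
  by (intro borel_measurable_continuous_onI continuous_on_stereo_factor)

lemma sets_volume: "sets sphere_vol = sets (restrict_space borel (sphere 0 1))"
  by (simp add: sphere_vol_def)

lemma space_volume: "space sphere_vol = sphere 0 1"
  by (simp add: sphere_vol_def space_restrict_space)

lemma sets_volume_iff: "A \<in> sets sphere_vol \<longleftrightarrow> A \<in> sets borel \<and> A \<subseteq> sphere 0 1"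
  by (auto simp: sets_volume sets_restrict_space_iff)

lemma measurable_param_sphere [measurable]: "param \<in> measurable borel (restrict_space borel (sphere 0 1))"
  by (rule measurable_restrict_space2) (auto simp: norm_param)

lemma emeasure_volume:
  assumes "A \<in> sets sphere_vol"
  shows "emeasure sphere_vol A = (\<integral>\<^sup>+z\<in>param -` A. ennreal (stereo_factor z ^ CARD('n)) \<partial>lborel)"
proof -
  have A: "A \<in> sets (restrict_space borel (sphere 0 1))" "A \<in> sets borel"
    using assms by (auto simp: sets_volume sets_restrict_space_iff)
  have "param -` A \<in> sets borel"
    using measurable_sets[OF measurable_param A(2)] by simp
  then show ?thesis
    using A by (simp add: sphere_vol_def emeasure_distr emeasure_density)
qed

text \<open>Change of variables asks for an integrand of finite total mass; in polar form this one
  is bounded by a constant on an interval of length \<open>pi\<close>.\<close>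

lemma nn_integral_stereo_factor_finite:
  "(\<integral>\<^sup>+z. ennreal (stereo_factor (z :: real ^ 'n) ^ CARD('n)) \<partial>lborel) < \<infinity>"
proof -
  have "(\<integral>\<^sup>+z. ennreal (stereo_factor (z :: real ^ 'n) ^ CARD('n)) \<partial>lborel) =
      ennreal (real CARD('n) * unit_ball_vol CARD('n)) *
      (\<integral>\<^sup>+\<theta>. ennreal (sin \<theta> ^ (CARD('n) - 1)) * indicator {0..<pi} \<theta> \<partial>lborel)"
    using nn_integral_stereo_factor[of "\<lambda>_. 1", where 'a = "real ^ 'n"] by simp
  also have "(\<integral>\<^sup>+\<theta>. ennreal (sin \<theta> ^ (CARD('n) - 1)) * indicator {0..<pi} \<theta> \<partial>lborel) \<le> (\<integral>\<^sup>+\<theta>. indicator {0..<pi} \<theta> \<partial>lborel)"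
    by (intro nn_integral_mono) (auto simp: power_le_one sin_ge_zero split: split_indicator)
  also have "\<dots> = ennreal pi" by simp
  finally have "(\<integral>\<^sup>+z. ennreal (stereo_factor (z :: real ^ 'n) ^ CARD('n)) \<partial>lborel) \<le>
      ennreal (real CARD('n) * unit_ball_vol CARD('n)) * ennreal pi"
    by (simp add: mult_left_mono)
  also have "\<dots> < \<infinity>" by (simp add: ennreal_mult_less_top)
  finally show ?thesis .
qed

section \<open>Existence: the area formula in an arbitrary local parametrisation\<close>

theorem emeasure_volume_local_param:
  assumes param': "local_param (sphere 0 1) U \<phi> \<phi>'" and A: "A \<in> sets sphere_vol" "A \<subseteq> \<phi> ` U"
  shows "emeasure sphere_vol A = (\<integral>\<^sup>+x\<in>(U \<inter> \<phi> -` A). ennreal (sqrt (det (metric_matrix (\<phi>' x)))) \<partial>lborel)"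
proof -
  have U: "open U" and der: "\<And>x. x \<in> U \<Longrightarrow> (\<phi> has_derivative blinfun_apply (\<phi>' x)) (at x)"
    and sub: "\<phi> ` U \<subseteq> sphere 0 1"
    using param' by (auto simp: local_param_def dest: openin_imp_subset)
  obtain \<psi> where \<psi>: "homeomorphism U (\<phi> ` U) \<phi> \<psi>" using param' by (auto simp: local_param_def)
  then have cont: "continuous_on U \<phi>" and inj: "inj_on \<phi> U"
    by (auto simp: homeomorphism_def inj_on_def) metis
  have A': "A \<in> sets borel" "A \<subseteq> sphere 0 1" using A by (auto simp: sets_volume_iff)
  \<comment> \<open>\<open>V\<close> is where the transition map \<open>\<tau>\<close> inverts the
    stereographic chart, and \<open>B\<close> is its part lying over \<open>A\<close>.\<close>
  define V where "V = U \<inter> \<phi> -` (- {- \<mu>})"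
  define B where "B = U \<inter> \<phi> -` (A - {- \<mu>})"
  define \<tau> where "\<tau> = coord \<circ> \<phi>"
  define \<tau>' where "\<tau>' = (\<lambda>x. frechet_derivative \<tau> (at x))"
  have V: "open V"
    unfolding V_def using U cont by (intro continuous_open_preimage) auto
  have BV: "B \<subseteq> V" by (auto simp: B_def V_def)
  have unit: "norm (\<phi> x) = 1" if "x \<in> U" for x using sub that by auto
  have pos: "0 < 1 + \<phi> x \<bullet> \<mu>" if "x \<in> V" for x
    using inner_pole_gt[of "\<phi> x"] unit[of x] that by (auto simp: V_def)
  have \<tau>: "param (\<tau> x) = \<phi> x" if "x \<in> V" for x
    using that unit[of x] by (auto simp: \<tau>_def V_def intro!: param_coord)
  have \<tau>_der: "(\<tau> has_derivative \<tau>' x) (at x)" if x: "x \<in> V" for x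
  proof -
    have "\<phi> differentiable at x" using der[of x] x by (auto simp: V_def differentiable_def)
    moreover from this have "(\<lambda>x. adjoint E (\<phi> x)) differentiable at x"
      using differentiable_chain_at[of \<phi> x "adjoint E"] linear_imp_differentiable[OF linear_adjoint]
      by (simp add: o_def)
    ultimately have "\<tau> differentiable at x"
      unfolding \<tau>_def coord_def o_def using pos[OF x]
      by (intro differentiable_scaleR differentiable_divide differentiable_add differentiable_inner differentiable_const) auto
    then show ?thesis unfolding \<tau>'_def by (rule frechet_derivative_works[THEN iffD1])
  qed
  \<comment> \<open>On the open set \<open>V\<close> the parametrisation \<open>\<phi>\<close>
    factors as \<open>param \<circ> \<tau>\<close>; differentiating gives the factorisation that
    \<open>metric_matrix_comp\<close> expects.\<close>
  have chain: "blinfun_apply (\<phi>' x) h = dparam (\<tau> x) (\<tau>' x h)" if x: "x \<in> V" for x h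
  proof -
    have "(param \<circ> \<tau> has_derivative dparam (\<tau> x) \<circ> \<tau>' x) (at x)"
      by (rule diff_chain_at[OF \<tau>_der[OF x] param_has_derivative])
    then have "(\<phi> has_derivative dparam (\<tau> x) \<circ> \<tau>' x) (at x)"
      by (rule has_derivative_transform_within_open[OF _ V x]) (simp add: \<tau>)
    then have "dparam (\<tau> x) \<circ> \<tau>' x = blinfun_apply (\<phi>' x)"
      by (rule has_derivative_unique) (use der x in \<open>auto simp: V_def\<close>)
    then show ?thesis by (metis comp_apply)
  qed
  have preim: "U \<inter> \<phi> -` X \<in> sets borel" if "X \<in> sets borel" for X
    using measurable_sets[OF borel_measurable_continuous_on_restrict[OF cont] that] U
    by (auto simp: sets_restrict_space_iff space_restrict_space Int_commute)
  have B: "B \<in> sets borel" unfolding B_def using A' by (intro preim) auto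
  \<comment> \<open>No coordinate is lost: \<open>A\<close> lies in the image of
    \<open>\<phi>\<close>, and \<open>param\<close> never takes the value
    \<open>- \<mu>\<close>.\<close>
  have \<tau>B: "\<tau> ` B = param -` A"
  proof (intro equalityI subsetI)
    fix z assume z: "z \<in> param -` A"
    then obtain x where "x \<in> U" "\<phi> x = param z" using A(2) by (metis imageE subsetD vimageD)
    then show "z \<in> \<tau> ` B"
      using z param_ne[of z] by (auto simp: \<tau>_def B_def coord_param intro!: image_eqI[of _ _ x])
  qed (use BV \<tau> in \<open>auto simp: B_def\<close>)
  have inj\<tau>: "inj_on \<tau> B"
    using inj \<tau> BV by (auto simp: inj_on_def B_def subset_iff) metis
  have "emeasure sphere_vol A = (\<integral>\<^sup>+z\<in>\<tau> ` B. ennreal (stereo_factor z ^ CARD('n)) \<partial>lborel)"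
    using A by (simp add: emeasure_volume \<tau>B)
  also have "\<dots> = (\<integral>\<^sup>+x\<in>B. ennreal (\<bar>det (matrix (\<tau>' x))\<bar> * stereo_factor (\<tau> x) ^ CARD('n)) \<partial>lborel)"
  proof (rule nn_integral_change_of_variables[symmetric])
    show "(\<tau> has_derivative \<tau>' x) (at x within B)" if "x \<in> B" for x
      using \<tau>_der BV that by (auto intro: has_derivative_at_withinI)
    show "\<tau> ` B \<in> sets borel"
      unfolding \<tau>B using measurable_sets[OF measurable_param A'(1)] by simp
  qed (use B inj\<tau> stereo_factor_pos nn_integral_stereo_factor_finite in \<open>auto intro: less_imp_le\<close>)
  also have "\<dots> = (\<integral>\<^sup>+x\<in>B. ennreal (sqrt (det (metric_matrix (\<phi>' x)))) \<partial>lborel)"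
    by (intro nn_integral_cong)
      (use metric_matrix_comp[OF chain] BV in \<open>auto simp: mult.commute split: split_indicator\<close>)
  \<comment> \<open>Since \<open>\<phi>\<close> is injective, at most one point of \<open>U\<close>
    lies over \<open>- \<mu>\<close>, so \<open>B\<close> and the full preimage of \<open>A\<close>
    agree up to a null set.\<close>
  also have "\<dots> = (\<integral>\<^sup>+x\<in>(U \<inter> \<phi> -` A). ennreal (sqrt (det (metric_matrix (\<phi>' x)))) \<partial>lborel)"
  proof (intro nn_integral_cong_AE)
    have "AE x in lborel. x \<notin> U \<inter> \<phi> -` {- \<mu>}"
    proof (cases "U \<inter> \<phi> -` {- \<mu>} = {}")
      case False
      then obtain a where "a \<in> U" "\<phi> a = - \<mu>" by auto
      then have "U \<inter> \<phi> -` {- \<mu>} = {a}" using inj by (auto simp: inj_on_def)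
      then show ?thesis using AE_lborel_singleton[of a] by simp
    qed auto
    then show "AE x in lborel. ennreal (sqrt (det (metric_matrix (\<phi>' x)))) * indicator B x =
        ennreal (sqrt (det (metric_matrix (\<phi>' x)))) * indicator (U \<inter> \<phi> -` A) x"
      by eventually_elim (auto simp: B_def split: split_indicator)
  qed
  finally show ?thesis .
qed

lemma is_riemannian_volume_volume: "is_riemannian_volume (sphere 0 1) sphere_vol"
  unfolding is_riemannian_volume_def using emeasure_volume_local_param sets_volume by auto

section \<open>Uniqueness of the volume measure\<close>

lemma is_riemannian_volume_param:
  assumes "is_riemannian_volume (sphere 0 1) V" "A \<in> sets V" "- \<mu> \<notin> A"
  shows "emeasure V A = (\<integral>\<^sup>+z\<in>param -` A. ennreal (stereo_factor z ^ CARD('n)) \<partial>lborel)"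
proof -
  have "A \<subseteq> range param"
    using assms by (auto simp: range_param is_riemannian_volume_def sets_restrict_space_iff subset_iff)
  then show ?thesis
    using assms(1,2) local_param_stereographic unfolding is_riemannian_volume_def
    by (auto simp: metric_matrix_dparam)
qed

text \<open>\<open>param\<close> does not reach this point, so the defining formula is read in the
  antipodal chart \<open>neg.param\<close>, which is injective: the preimage has at most one
  element.\<close>

lemma is_riemannian_volume_pole:
  assumes V: "is_riemannian_volume (sphere 0 1) V"
  shows "emeasure V {- \<mu>} = 0"
proof -
  interpret neg: stereographic "- \<mu>" E by (rule stereographic_uminus)
  have "{- \<mu>} \<in> sets V"
    using V norm_pole by (auto simp: is_riemannian_volume_def sets_restrict_space_iff)
  moreover have "- (- \<mu>) \<notin> {- \<mu>}"
  proof
    assume "- (- \<mu>) \<in> {- \<mu>}"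
    then have "\<mu> \<bullet> \<mu> = (- \<mu>) \<bullet> \<mu>" by (metis add.inverse_inverse singletonD)
    then show False using pole_inner by simp
  qed
  ultimately have "emeasure V {- \<mu>} = (\<integral>\<^sup>+z\<in>neg.param -` {- \<mu>}. ennreal (stereo_factor z ^ CARD('n)) \<partial>lborel)"
    using neg.is_riemannian_volume_param[OF V] by blast
  also have "\<dots> = (\<integral>\<^sup>+(z::real ^ 'n). 0 \<partial>lborel)"
  proof (intro nn_integral_cong_AE)
    have "z = neg.coord (- \<mu>)" if "neg.param z = - \<mu>" for z
      using neg.coord_param[of z] that by simp
    then show "AE z in lborel. ennreal (stereo_factor z ^ CARD('n)) * indicator (neg.param -` {- \<mu>}) z = 0"
      using AE_lborel_singleton[of "neg.coord (- \<mu>)"] by (auto elim!: eventually_mono split: split_indicator)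
  qed
  finally show ?thesis by simp
qed

lemma is_riemannian_volume_unique:
  assumes V: "is_riemannian_volume (sphere 0 1) V"
  shows "V = sphere_vol"
proof (rule measure_eqI)
  show sets: "sets V = sets sphere_vol" using V by (simp add: is_riemannian_volume_def sets_volume)
  fix A assume A: "A \<in> sets V"
  have p: "{- \<mu>} \<in> sets sphere_vol" using norm_pole by (simp add: sets_volume_iff)
  have null: "{- \<mu>} \<in> null_sets V" "{- \<mu>} \<in> null_sets sphere_vol"
    using is_riemannian_volume_pole[OF V] is_riemannian_volume_pole[OF is_riemannian_volume_volume] p sets by auto
  have "emeasure V A = emeasure V (A - {- \<mu>})"
    using A null by (simp add: emeasure_Diff_null_set)
  also have "\<dots> = emeasure sphere_vol (A - {- \<mu>})"
    using A p sets is_riemannian_volume_param[OF V, of "A - {- \<mu>}"]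
      is_riemannian_volume_param[OF is_riemannian_volume_volume, of "A - {- \<mu>}"] by simp
  also have "\<dots> = emeasure sphere_vol A"
    using A sets null by (simp add: emeasure_Diff_null_set)
  finally show "emeasure V A = emeasure sphere_vol A" .
qed

lemma riemannian_volume_sphere: "riemannian_volume (sphere 0 1) = sphere_vol"
  unfolding riemannian_volume_def
  using is_riemannian_volume_volume is_riemannian_volume_unique by (rule the_equality)

section \<open>Integrals of functions of the angle to the pole\<close>

lemma measurable_arccos_inner_pole:
  "(\<lambda>y. arccos (y \<bullet> \<mu>)) \<in> borel_measurable (restrict_space borel (sphere 0 1))"
proof (rule borel_measurable_continuous_on_restrict, rule continuous_on_arccos)
  show "\<forall>y\<in>sphere 0 1. - 1 \<le> y \<bullet> \<mu> \<and> y \<bullet> \<mu> \<le> 1"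
  proof
    fix y :: "real ^ ('n + 1)" assume "y \<in> sphere 0 1"
    then have "\<bar>y \<bullet> \<mu>\<bar> \<le> 1"
      using Cauchy_Schwarz_ineq2[of y \<mu>] by (simp add: norm_pole)
    then show "- 1 \<le> y \<bullet> \<mu> \<and> y \<bullet> \<mu> \<le> 1" by (auto simp: abs_le_iff)
  qed
qed (intro continuous_intros)

lemma nn_integral_volume:
  fixes f :: "real \<Rightarrow> ennreal"
  assumes [measurable]: "f \<in> borel_measurable borel"
  shows "(\<integral>\<^sup>+y. f (arccos (y \<bullet> \<mu>)) \<partial>sphere_vol) =
    ennreal (real CARD('n) * unit_ball_vol CARD('n)) *
      (\<integral>\<^sup>+\<theta>. f \<theta> * ennreal (sin \<theta> ^ (CARD('n) - 1)) * indicator {0..<pi} \<theta> \<partial>lborel)"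
proof -
  \<comment> \<open>\<open>arccos\<close> inverts \<open>cos\<close> here because
    \<open>2 * arctan (norm z)\<close> lies in \<open>{0..<pi}\<close>.\<close>
  have ac: "arccos (param z \<bullet> \<mu>) = 2 * arctan (norm z)" for z
  proof -
    have "param z \<bullet> \<mu> = cos (2 * arctan (norm z))"
      unfolding param_inner_pole stereo_factor_def stereo_factor_two_arctan(2) ..
    then show ?thesis
      using arctan_ubound[of "norm z"] by (simp add: arccos_cos)
  qed
  note [measurable] = measurable_arccos_inner_pole
  have "(\<integral>\<^sup>+y. f (arccos (y \<bullet> \<mu>)) \<partial>sphere_vol) =
      (\<integral>\<^sup>+z. f (arccos (param z \<bullet> \<mu>)) \<partial>density lborel (\<lambda>z. ennreal (stereo_factor z ^ CARD('n))))"
    unfolding sphere_vol_def by (intro nn_integral_distr) auto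
  also have "\<dots> = (\<integral>\<^sup>+z. ennreal (stereo_factor z ^ CARD('n)) * f (arccos (param z \<bullet> \<mu>)) \<partial>lborel)"
    by (intro nn_integral_density) measurable
  also have "\<dots> = (\<integral>\<^sup>+z. f (2 * arctan (norm (z :: real ^ 'n))) * ennreal (stereo_factor z ^ CARD('n)) \<partial>lborel)"
    by (simp add: ac mult.commute)
  also have "\<dots> = ennreal (real CARD('n) * unit_ball_vol CARD('n)) *
      (\<integral>\<^sup>+\<theta>. f \<theta> * ennreal (sin \<theta> ^ (CARD('n) - 1)) * indicator {0..<pi} \<theta> \<partial>lborel)"
    using nn_integral_stereo_factor[of f, where 'a = "real ^ 'n"] by simp
  finally show ?thesis .
qed

end

text \<open>The hyperplane orthogonal to \<open>\<mu>\<close> has the dimension of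
  \<open>real ^ 'n\<close>, and subspaces of equal dimension are isometric.\<close>

lemma stereographic_exists:
  fixes \<mu> :: "real ^ ('n::finite + 1)"
  assumes "norm \<mu> = 1"
  obtains E :: "real ^ 'n \<Rightarrow> real ^ ('n + 1)" where "stereographic \<mu> E"
proof -
  have "\<mu> \<noteq> 0" using assms by auto
  then have "dim {y. \<mu> \<bullet> y = 0} = DIM(real ^ ('n + 1)) - 1" by (rule dim_hyperplane)
  then have "dim (UNIV :: (real ^ 'n) set) = dim {y. \<mu> \<bullet> y = 0}" by simp
  from isometry_subspaces[OF subspace_UNIV subspace_hyperplane this]
  obtain E :: "real ^ 'n \<Rightarrow> real ^ ('n + 1)"
    where "linear E" "range E = {y. \<mu> \<bullet> y = 0}" "\<And>x. norm (E x) = norm x" by auto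
  then show ?thesis
    using that assms by (auto simp: stereographic_def inner_commute)
qed

subsection \<open>The Riemannian normal distribution\<close>

context stereographic
begin

lemma nn_integral_volume_cap:
  assumes R: "0 \<le> R" "R \<le> pi" and v: "0 < v"
  shows "(\<integral>\<^sup>+y. ennreal (exp (- (arccos (y \<bullet> \<mu>))\<^sup>2 / (2 * v))) * indicator {..R} (arccos (y \<bullet> \<mu>)) \<partial>sphere_vol) =
    ennreal (real CARD('n) * unit_ball_vol CARD('n) * integral {0..R} (\<lambda>r. exp (- r\<^sup>2 / (2 * v)) * sin r ^ (CARD('n) - 1)))"
proof -
  let ?g = "\<lambda>r. exp (- r\<^sup>2 / (2 * v)) * sin r ^ (CARD('n) - 1)"
  have g: "(?g has_integral integral {0..R} ?g) {0..R}"
    using v by (intro integrable_integral integrable_continuous_real continuous_intros) auto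
  have "(\<integral>\<^sup>+y. ennreal (exp (- (arccos (y \<bullet> \<mu>))\<^sup>2 / (2 * v))) * indicator {..R} (arccos (y \<bullet> \<mu>)) \<partial>sphere_vol) =
      ennreal (real CARD('n) * unit_ball_vol CARD('n)) *
        (\<integral>\<^sup>+\<theta>. ennreal (exp (- \<theta>\<^sup>2 / (2 * v))) * indicator {..R} \<theta> *
          ennreal (sin \<theta> ^ (CARD('n) - 1)) * indicator {0..<pi} \<theta> \<partial>lborel)"
    by (rule nn_integral_volume[of "\<lambda>\<theta>. ennreal (exp (- \<theta>\<^sup>2 / (2 * v))) * indicator {..R} \<theta>"]) measurable
  also have "(\<integral>\<^sup>+\<theta>. ennreal (exp (- \<theta>\<^sup>2 / (2 * v))) * indicator {..R} \<theta> *
        ennreal (sin \<theta> ^ (CARD('n) - 1)) * indicator {0..<pi} \<theta> \<partial>lborel) = (\<integral>\<^sup>+\<theta>. ennreal (?g \<theta>) * indicator {0..R} \<theta> \<partial>lborel)"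
  proof (intro nn_integral_cong_AE)
    \<comment> \<open>The half-open range omits the angle \<open>pi\<close>, which makes a
      difference only for \<open>R = pi\<close>, and then only on a null set.\<close>
    show "AE \<theta> in lborel. ennreal (exp (- \<theta>\<^sup>2 / (2 * v))) * indicator {..R} \<theta> *
        ennreal (sin \<theta> ^ (CARD('n) - 1)) * indicator {0..<pi} \<theta> = ennreal (?g \<theta>) * indicator {0..R} \<theta>"
      using AE_lborel_singleton[of pi]
    proof eventually_elim
      case (elim \<theta>)
      then show ?case
        using R by (auto simp: ennreal_mult' split: split_indicator)
    qed
  qed
  also have "\<dots> = ennreal (integral {0..R} ?g)"
    using R by (intro nn_integral_has_integral_lebesgue'[OF _ g]) (auto intro!: mult_nonneg_nonneg sin_ge_zero zero_le_power)
  finally show ?thesis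
    by (simp add: ennreal_mult')
qed

text \<open>The case \<open>R = pi\<close> of the cap integral, where the cap is the whole sphere.
  The integrand is nonnegative, so the Bochner integral can be read off from the extended
  one.\<close>

lemma integral_volume:
  assumes v: "0 < v"
  shows "(\<integral>y. exp (- (arccos (y \<bullet> \<mu>))\<^sup>2 / (2 * v)) \<partial>sphere_vol) =
    real CARD('n) * unit_ball_vol CARD('n) * integral {0..pi} (\<lambda>r. exp (- r\<^sup>2 / (2 * v)) * sin r ^ (CARD('n) - 1))"
    (is "_ = _ * integral _ ?g")
proof -
  note [measurable] = measurable_arccos_inner_pole
  have ang: "arccos (y \<bullet> \<mu>) \<le> pi" if "y \<in> sphere 0 1" for y
    using that Cauchy_Schwarz_ineq2[of y \<mu>] by (intro arccos_ubound) (auto simp: norm_pole abs_le_iff)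
  have nonneg: "0 \<le> integral {0..pi} ?g"
    by (intro Henstock_Kurzweil_Integration.integral_nonneg integrable_continuous_real continuous_intros)
      (use v in \<open>auto intro!: mult_nonneg_nonneg sin_ge_zero zero_le_power\<close>)
  have "(\<lambda>y. exp (- (arccos (y \<bullet> \<mu>))\<^sup>2 / (2 * v))) \<in> borel_measurable sphere_vol"
    unfolding measurable_cong_sets[OF sets_volume refl] by measurable
  then have "(\<integral>y. exp (- (arccos (y \<bullet> \<mu>))\<^sup>2 / (2 * v)) \<partial>sphere_vol) =
      enn2real (\<integral>\<^sup>+y. ennreal (exp (- (arccos (y \<bullet> \<mu>))\<^sup>2 / (2 * v))) \<partial>sphere_vol)"
    by (intro integral_eq_nn_integral) auto
  also have "(\<integral>\<^sup>+y. ennreal (exp (- (arccos (y \<bullet> \<mu>))\<^sup>2 / (2 * v))) \<partial>sphere_vol) =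
      (\<integral>\<^sup>+y. ennreal (exp (- (arccos (y \<bullet> \<mu>))\<^sup>2 / (2 * v))) * indicator {..pi} (arccos (y \<bullet> \<mu>)) \<partial>sphere_vol)"
    by (intro nn_integral_cong) (auto simp: space_volume ang split: split_indicator)
  also have "\<dots> = ennreal (real CARD('n) * unit_ball_vol CARD('n) * integral {0..pi} ?g)"
    using v by (intro nn_integral_volume_cap) auto
  finally show ?thesis using nonneg by simp
qed

end

theorem proposition4:
  fixes \<mu> :: "real ^ ('n::finite + 1)" and v :: real
    and S :: "(real ^ ('n + 1)) set" and n :: nat
  defines "S \<equiv> sphere 0 1" and "n \<equiv> CARD('n)"
  assumes "v > 0" and "\<mu> \<in> S"
  shows "complex_of_real (riemannian_normal_const S \<mu> v) =
           complex_of_real (2 * pi powr (real n / 2) / Gamma (real n / 2)) *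
             (G (n - 1) v pi - G (n - 1) v 0)
       \<and> (\<forall>y\<in>S. complex_of_real (riemannian_normal_density S \<mu> v y) =
           complex_of_real (exp (- (geodesic_dist S y \<mu>)\<^sup>2 / (2 * v))) /
             (complex_of_real (2 * pi powr (real n / 2) / Gamma (real n / 2)) *
               (G (n - 1) v pi - G (n - 1) v 0)))
       \<and> (\<forall>(M :: 'w measure) Y. prob_space M \<and>
            distributed M (riemannian_volume S) Y
              (\<lambda>y. ennreal (riemannian_normal_density S \<mu> v y)) \<longrightarrow>
            (\<forall>R::real. complex_of_real
               (measure M {\<omega> \<in> space M. geodesic_dist S (Y \<omega>) \<mu> \<le> R}) =
                 (if R < 0 then 0
                  else if R \<le> pi then
                    (G (n - 1) v R - G (n - 1) v 0) / (G (n - 1) v pi - G (n - 1) v 0)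
                  else 1)))"
proof -
  have \<mu>: "norm \<mu> = 1" using \<open>\<mu> \<in> S\<close> by (simp add: S_def)
  obtain E :: "real ^ 'n \<Rightarrow> real ^ ('n + 1)" where "stereographic \<mu> E"
    using stereographic_exists[OF \<mu>] .
  then interpret stereographic \<mu> E .
  have n: "n > 0" by (simp add: n_def)
  define \<kappa> where "\<kappa> = 2 * pi powr (real n / 2) / Gamma (real n / 2)"
  have \<kappa>: "real CARD('n) * unit_ball_vol CARD('n) = \<kappa>"
    using sphere_area_constant[OF n] by (simp add: \<kappa>_def n_def)
  have \<kappa>_pos: "\<kappa> > 0"
    unfolding \<kappa>[symmetric] by simp
  \<comment> \<open>\<open>I R\<close> is the real number behind the increment of \<open>G\<close>
    from 0 to \<open>R\<close>; the argument works with it, and the complex form returns only in the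
    conclusions.\<close>
  define I where "I = (\<lambda>R. integral {0..R} (\<lambda>r. exp (- r\<^sup>2 / (2 * v)) * sin r ^ (n - 1)))"
  have G: "G (n - 1) v R - G (n - 1) v 0 = complex_of_real (I R)" if "0 \<le> R" for R
    unfolding I_def using \<open>v > 0\<close> that by (rule G_diff_eq_integral)
  have I_nonneg: "0 \<le> I R" if "0 \<le> R" "R \<le> pi" for R
    unfolding I_def
    by (intro Henstock_Kurzweil_Integration.integral_nonneg integrable_continuous_real continuous_intros)
      (use \<open>v > 0\<close> that in \<open>auto intro!: mult_nonneg_nonneg sin_ge_zero zero_le_power\<close>)
  have dist: "geodesic_dist S y \<mu> = arccos (y \<bullet> \<mu>)" if "y \<in> S" for y
    using that \<mu> unfolding S_def by (intro geodesic_dist_sphere) auto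
  have dist_bounds: "0 \<le> geodesic_dist S y \<mu>" "geodesic_dist S y \<mu> \<le> pi" if "y \<in> S" for y
  proof -
    have "\<bar>y \<bullet> \<mu>\<bar> \<le> 1"
      using that Cauchy_Schwarz_ineq2[of y \<mu>] \<mu> by (simp add: S_def)
    then show "0 \<le> geodesic_dist S y \<mu>" "geodesic_dist S y \<mu> \<le> pi"
      unfolding dist[OF that] by (auto simp: abs_le_iff intro!: arccos_lbound arccos_ubound)
  qed
  have vol: "riemannian_volume S = sphere_vol"
    unfolding S_def by (rule riemannian_volume_sphere)
  have const: "riemannian_normal_const S \<mu> v = \<kappa> * I pi"
  proof -
    have "riemannian_normal_const S \<mu> v = (\<integral>y. exp (- (arccos (y \<bullet> \<mu>))\<^sup>2 / (2 * v)) \<partial>sphere_vol)"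
      unfolding riemannian_normal_const_def vol
      by (intro Bochner_Integration.integral_cong) (auto simp: space_volume dist[unfolded S_def] S_def)
    then show ?thesis
      using integral_volume[OF \<open>v > 0\<close>] by (simp add: \<kappa>[symmetric] I_def n_def)
  qed
  have prob: "complex_of_real (measure M {\<omega> \<in> space M. geodesic_dist S (Y \<omega>) \<mu> \<le> R}) =
      (if R < 0 then 0 else if R \<le> pi then (G (n - 1) v R - G (n - 1) v 0) / (G (n - 1) v pi - G (n - 1) v 0) else 1)"
    if M: "prob_space M" and Y: "distributed M (riemannian_volume S) Y (\<lambda>y. ennreal (riemannian_normal_density S \<mu> v y))"
    for M :: "'w measure" and Y R
  proof -
    \<comment> \<open>\<open>distributed\<close> makes \<open>Y\<close> measurable into the space of
      the volume measure, which is \<open>S\<close> itself. So \<open>Y\<close> lies in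
      \<open>S\<close> everywhere, and for \<open>R < 0\<close> or \<open>R > pi\<close> the event
      is exactly empty or everything.\<close>
    have Y_S: "Y \<omega> \<in> S" if "\<omega> \<in> space M" for \<omega>
      using measurable_space[OF distributed_measurable[OF Y] that] by (simp add: vol[unfolded S_def] space_volume S_def)
    consider "R < 0" | "0 \<le> R" "R \<le> pi" | "pi < R" by linarith
    then show ?thesis
    proof cases
      case 1
      then have eq: "{\<omega> \<in> space M. geodesic_dist S (Y \<omega>) \<mu> \<le> R} = {}"
        using Y_S dist_bounds(1) by fastforce
      show ?thesis unfolding eq using 1 by simp
    next
      case 3
      then have eq: "{\<omega> \<in> space M. geodesic_dist S (Y \<omega>) \<mu> \<le> R} = space M"
        using Y_S dist_bounds(2) by fastforce
      have "\<not> R < 0" "\<not> R \<le> pi" using 3 pi_gt_zero by linarith+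
      then show ?thesis unfolding eq by (simp add: prob_space.prob_space[OF M])
    next
      case 2
      define A where "A = {y \<in> S. arccos (y \<bullet> \<mu>) \<le> R}"
      note [measurable] = measurable_arccos_inner_pole
      have A: "A \<in> sets sphere_vol"
      proof -
        have "{y \<in> space (restrict_space borel (sphere 0 1)). arccos (y \<bullet> \<mu>) \<le> R} \<in> sets (restrict_space borel (sphere 0 1))"
          by measurable
        then show ?thesis by (simp add: sets_volume A_def S_def space_restrict_space)
      qed
      have meas: "(\<lambda>y. ennreal (exp (- (arccos (y \<bullet> \<mu>))\<^sup>2 / (2 * v))) * indicator {..R} (arccos (y \<bullet> \<mu>))) \<in> borel_measurable sphere_vol"
        unfolding measurable_cong_sets[OF sets_volume refl] by measurable
      have "{\<omega> \<in> space M. geodesic_dist S (Y \<omega>) \<mu> \<le> R} = Y -` A \<inter> space M"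
        using Y_S dist by (auto simp: A_def)
      then have "emeasure M {\<omega> \<in> space M. geodesic_dist S (Y \<omega>) \<mu> \<le> R} =
          (\<integral>\<^sup>+y. ennreal (riemannian_normal_density S \<mu> v y) * indicator A y \<partial>sphere_vol)"
        using distributed_emeasure[OF Y] A by (simp add: vol)
      also have "\<dots> = (\<integral>\<^sup>+y. ennreal (1 / (\<kappa> * I pi)) *
          (ennreal (exp (- (arccos (y \<bullet> \<mu>))\<^sup>2 / (2 * v))) * indicator {..R} (arccos (y \<bullet> \<mu>))) \<partial>sphere_vol)"
      proof (intro nn_integral_cong)
        fix y assume "y \<in> space sphere_vol"
        then have y: "y \<in> S" by (simp add: space_volume S_def)
        have "ennreal (riemannian_normal_density S \<mu> v y) =
            ennreal (1 / (\<kappa> * I pi)) * ennreal (exp (- (arccos (y \<bullet> \<mu>))\<^sup>2 / (2 * v)))"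
          using \<kappa>_pos I_nonneg[of pi] y
          by (subst ennreal_mult[symmetric]) (auto simp: riemannian_normal_density_def const dist)
        then show "ennreal (riemannian_normal_density S \<mu> v y) * indicator A y = ennreal (1 / (\<kappa> * I pi)) *
          (ennreal (exp (- (arccos (y \<bullet> \<mu>))\<^sup>2 / (2 * v))) * indicator {..R} (arccos (y \<bullet> \<mu>)))"
          using y by (auto simp: A_def split: split_indicator)
      qed
      also have "\<dots> = ennreal (1 / (\<kappa> * I pi)) * ennreal (\<kappa> * I R)"
        using nn_integral_cmult[OF meas] nn_integral_volume_cap[OF 2 \<open>v > 0\<close>]
        by (simp add: \<kappa> I_def n_def)
      \<comment> \<open>The factor \<open>\<kappa>\<close> of the normalizing constant meets that of
        the cap integral and cancels, leaving a ratio of increments of \<open>G\<close>.\<close>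
      also have "\<dots> = ennreal (I R / I pi)"
        using \<kappa>_pos I_nonneg[OF 2] I_nonneg[of pi]
        by (subst ennreal_mult[symmetric]) auto
      finally have "measure M {\<omega> \<in> space M. geodesic_dist S (Y \<omega>) \<mu> \<le> R} = I R / I pi"
        using I_nonneg[OF 2] I_nonneg[of pi] by (simp add: measure_def)
      then show ?thesis
        unfolding G[OF 2(1)] G[OF pi_ge_zero] using 2 by simp
    qed
  qed
  show ?thesis
    unfolding \<kappa>_def[symmetric]
  proof (intro conjI ballI allI impI)
    show "complex_of_real (riemannian_normal_const S \<mu> v) = complex_of_real \<kappa> * (G (n - 1) v pi - G (n - 1) v 0)"
      unfolding G[OF pi_ge_zero] const by simp
    show "complex_of_real (riemannian_normal_density S \<mu> v y) =
        complex_of_real (exp (- (geodesic_dist S y \<mu>)\<^sup>2 / (2 * v))) / (complex_of_real \<kappa> * (G (n - 1) v pi - G (n - 1) v 0))" for y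
      unfolding G[OF pi_ge_zero] riemannian_normal_density_def const by simp
  qed (use prob in blast)
qed

end
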